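(* The canonical endomorphism $\widetilde\varphi$ of $\mathcal{Q}_2$, defined by $\widetilde\varphi(x)=US_2xS_2^*U^*+S_2xS_2^*$ for $x\in\mathcal{Q}_2$, is a shift, i.e. $\bigcap_{k}\widetilde\varphi^{\,k}(\mathcal{Q}_2)=\mathbb{C}1$, the intersection being over all positive integers $k$.
   Context: The $2$-adic ring $C^*$-algebra $\mathcal{Q}_2$ is the universal (unital) $C^*$-algebra generated by a unitary $U$ and an isometry $S_2$ satisfying $S_2U=U^2S_2$ and $S_2S_2^*+US_2S_2^*U^*=1$. Here $\widetilde\varphi^{\,k}$ denotes the $k$-fold composition of $\widetilde\varphi$ with itself. *)

theory Defs
  imports "HOL-Analysis.Analysis" "HOL-Library.Poly_Mapping"
begin

section \<open>Unital \<open>C\<^sup>*\<close>-algebras\<close>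

class scaleC =
  fixes scaleC :: "complex \<Rightarrow> 'a \<Rightarrow> 'a"  (infixr "*\<^sub>C" 75)

class adjoint =
  fixes adj :: "'a \<Rightarrow> 'a"  ("_\<^sup>\<star>" [1000] 999)

text \<open>
  The real structure of \<^class>\<open>real_normed_algebra\<close> is the restriction of the complex one.
  The class is based on \<^class>\<open>monoid_mult\<close> and not on \<^class>\<open>ring_1\<close> because the latter would
  exclude the zero algebra.
\<close>

class unital_cstar_algebra = real_normed_algebra + banach + monoid_mult + scaleC + adjoint +
  assumes scaleC_add_right: "c *\<^sub>C (x + y) = c *\<^sub>C x + c *\<^sub>C y"
    and scaleC_add_left: "(c + d) *\<^sub>C x = c *\<^sub>C x + d *\<^sub>C x"
    and scaleC_scaleC: "c *\<^sub>C d *\<^sub>C x = (c * d) *\<^sub>C x"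
    and scaleR_scaleC: "r *\<^sub>R x = complex_of_real r *\<^sub>C x"
    and mult_scaleC_left: "(c *\<^sub>C x) * y = c *\<^sub>C (x * y)"
    and mult_scaleC_right: "x * (c *\<^sub>C y) = c *\<^sub>C (x * y)"
    and norm_scaleC: "norm (c *\<^sub>C x) = cmod c * norm x"
    and adj_adj: "(x\<^sup>\<star>)\<^sup>\<star> = x"
    and adj_add: "(x + y)\<^sup>\<star> = x\<^sup>\<star> + y\<^sup>\<star>"
    and adj_scaleC: "(c *\<^sub>C x)\<^sup>\<star> = cnj c *\<^sub>C x\<^sup>\<star>"
    and adj_mult: "(x * y)\<^sup>\<star> = y\<^sup>\<star> * x\<^sup>\<star>"
    and cstar_identity: "norm (x\<^sup>\<star> * x) = (norm x)\<^sup>2"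

definition unital_star_hom ::
  "('a::unital_cstar_algebra \<Rightarrow> 'b::unital_cstar_algebra) \<Rightarrow> bool" where
  "unital_star_hom f \<longleftrightarrow>
     (\<forall>x y. f (x + y) = f x + f y) \<and> (\<forall>c x. f (c *\<^sub>C x) = c *\<^sub>C f x) \<and>
     (\<forall>x y. f (x * y) = f x * f y) \<and> (\<forall>x. f (x\<^sup>\<star>) = (f x)\<^sup>\<star>) \<and> f 1 = 1"

definition Q2_relations :: "'a::unital_cstar_algebra \<Rightarrow> 'a \<Rightarrow> bool" where
  "Q2_relations u s \<longleftrightarrow>
     u\<^sup>\<star> * u = 1 \<and> u * u\<^sup>\<star> = 1 \<and> s\<^sup>\<star> * s = 1 \<and> s * u = u\<^sup>2 * s \<and>
     s * s\<^sup>\<star> + u * s * s\<^sup>\<star> * u\<^sup>\<star> = 1"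


section \<open>The free unital \<open>*\<close>-algebra on two generators\<close>

datatype generator = GU | GS

text \<open>A letter \<open>(g, False)\<close> stands for the generator \<open>g\<close>, and \<open>(g, True)\<close> for its adjoint.\<close>

datatype word = Word (letters: "(generator \<times> bool) list")

instantiation word :: monoid_add
begin
definition "0 = Word []"
definition "v + w = Word (letters v @ letters w)"
instance by standard (auto simp: zero_word_def plus_word_def)
end

text \<open>The monoid algebra of the free monoid, with convolution as multiplication.\<close>

type_synonym free_alg = "word \<Rightarrow>\<^sub>0 complex"

definition free_scale :: "complex \<Rightarrow> free_alg \<Rightarrow> free_alg" where
  "free_scale c x = Poly_Mapping.single 0 c * x"

definition word_adj :: "word \<Rightarrow> word" where
  "word_adj w = Word (rev (map (\<lambda>(g, b). (g, \<not> b)) (letters w)))"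

lemma word_adj_adj [simp]: "word_adj (word_adj w) = w"
  by (cases w) (auto simp: word_adj_def rev_map o_def case_prod_beta)

lemma word_adj_add: "word_adj (v + w) = word_adj w + word_adj v"
  by (auto simp: word_adj_def plus_word_def)

lemma word_adj_0 [simp]: "word_adj 0 = 0"
  by (auto simp: word_adj_def zero_word_def)

lift_definition free_adj :: "free_alg \<Rightarrow> free_alg" is "\<lambda>x w. cnj (x (word_adj w))"
proof -
  fix x :: "word \<Rightarrow> complex"
  assume "finite {w. x w \<noteq> 0}"
  moreover have "{w. cnj (x (word_adj w)) \<noteq> 0} \<subseteq> word_adj ` {w. x w \<noteq> 0}"
    by (auto intro: image_eqI[of _ _ "word_adj w" for w])
  ultimately show "finite {w. cnj (x (word_adj w)) \<noteq> 0}"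
    by (meson finite_imageI finite_subset)
qed

abbreviation "letter g b \<equiv> (Poly_Mapping.single (Word [(g, b)]) 1 :: free_alg)"

definition "free_U = letter GU False"
definition "free_S = letter GS False"

definition relators :: "free_alg set" where
  "relators =
    (let u = free_U; s = free_S; a = free_adj in
      {a u * u - 1, u * a u - 1, a s * s - 1, s * u - u\<^sup>2 * s,
       s * a s + u * s * a s * a u - 1})"

lemma free_induct [case_names single add]:
  assumes "\<And>w c. P (Poly_Mapping.single w c)" and "\<And>x y. P x \<Longrightarrow> P y \<Longrightarrow> P (x + y)"
  shows "P (x::free_alg)"
proof (induction x rule: update_induct)
  case const
  show ?case using assms(1)[of 0 0] by simp
next
  case (update f a b)
  have "Poly_Mapping.update a b f = f + Poly_Mapping.single a b"
    using update(1) by (intro poly_mapping_eqI)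
      (auto simp: lookup_update lookup_add lookup_single in_keys_iff when_def)
  with update assms show ?case by metis
qed

lemma free_scale_single: "free_scale c (Poly_Mapping.single w d) = Poly_Mapping.single w (c * d)"
  by (simp add: free_scale_def mult_single)

lemma free_scale_add: "free_scale c (x + y) = free_scale c x + free_scale c y"
  by (simp add: free_scale_def distrib_left)

lemma free_scale_add_left: "free_scale (c + d) x = free_scale c x + free_scale d x"
  by (simp add: free_scale_def single_add distrib_right)

lemma free_scale_scale: "free_scale c (free_scale d x) = free_scale (c * d) x"
  by (simp add: free_scale_def mult_single mult.assoc[symmetric])

lemma free_scale_one [simp]: "free_scale 1 x = x"
  by (simp add: free_scale_def)

lemma free_scale_minus_one [simp]: "free_scale (-1) x = - x"
  by (simp add: free_scale_def single_uminus)

lemma free_scale_mult_left: "free_scale c x * y = free_scale c (x * y)"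
  by (simp add: free_scale_def mult.assoc)

lemma single_0_central: "x * Poly_Mapping.single 0 c = Poly_Mapping.single 0 c * (x::free_alg)"
  by (induction x rule: free_induct) (simp_all add: mult_single mult.commute distrib_left distrib_right)

lemma free_scale_mult_right: "x * free_scale c y = free_scale c (x * y)"
  by (simp add: free_scale_def mult.assoc[symmetric] single_0_central)

lemma free_scale_diff: "free_scale c (x - y) = free_scale c x - free_scale c y"
  by (simp add: free_scale_def algebra_simps)

lemma free_adj_add: "free_adj (x + y) = free_adj x + free_adj y"
  by transfer auto

lemma free_adj_diff: "free_adj (x - y) = free_adj x - free_adj y"
  by transfer auto

lemma free_adj_adj [simp]: "free_adj (free_adj x) = x"
  by transfer simp

lemma free_adj_single:
  "free_adj (Poly_Mapping.single w c) = Poly_Mapping.single (word_adj w) (cnj c)"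
proof -
  have "(cnj c when w = word_adj v) = (cnj c when word_adj w = v)" for v
    by (metis (mono_tags, lifting) word_adj_adj when_def)
  then show ?thesis
    by (intro poly_mapping_eqI) (auto simp: free_adj.rep_eq lookup_single when_def)
qed

lemma free_adj_1 [simp]: "free_adj 1 = 1"
  using free_adj_single[of 0 1] by simp

lemma free_adj_mult: "free_adj (x * y) = free_adj y * free_adj x"
proof (induction x rule: free_induct)
  case (single v c)
  show ?case
    by (induction y rule: free_induct)
      (simp_all add: mult_single free_adj_single word_adj_add mult.commute free_adj_add
        distrib_left distrib_right)
qed (simp add: distrib_left distrib_right free_adj_add)

lemma free_adj_scale: "free_adj (free_scale c x) = free_scale (cnj c) (free_adj x)"
  by (simp add: free_scale_def free_adj_mult free_adj_single single_0_central)


section \<open>The universal \<open>C\<^sup>*\<close>-seminorm\<close>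

definition cstar_seminorm :: "(free_alg \<Rightarrow> real) \<Rightarrow> bool" where
  "cstar_seminorm p \<longleftrightarrow>
     (\<forall>x y. p (x + y) \<le> p x + p y) \<and> (\<forall>c x. p (free_scale c x) = cmod c * p x) \<and>
     (\<forall>x y. p (x * y) \<le> p x * p y) \<and> (\<forall>x. p (free_adj x * x) = (p x)\<^sup>2)"

definition admissible :: "(free_alg \<Rightarrow> real) set" where
  "admissible = {p. cstar_seminorm p \<and> (\<forall>r\<in>relators. p r = 0)}"

definition univ_norm :: "free_alg \<Rightarrow> real" where
  "univ_norm x = (SUP p\<in>admissible. p x)"

context
  fixes p assumes p: "cstar_seminorm p"
begin

lemma cs_add: "p (x + y) \<le> p x + p y"
  and cs_scale: "p (free_scale c x) = cmod c * p x"
  and cs_mult: "p (x * y) \<le> p x * p y"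
  and cs_star: "p (free_adj x * x) = (p x)\<^sup>2"
  using p by (auto simp: cstar_seminorm_def)

lemma cs_0: "p 0 = 0"
  using cs_scale[of 0 0] by (simp add: free_scale_def)

lemma cs_minus: "p (- x) = p x"
  using cs_scale[of "-1" x] by simp

lemma cs_ge_0: "p x \<ge> 0"
  using cs_add[of x "-x"] by (simp add: cs_0 cs_minus)

lemma cs_diff: "p (x - y) \<le> p x + p y"
  using cs_add[of x "-y"] by (simp add: cs_minus)

lemma cs_diff_commute: "p (x - y) = p (y - x)"
  using cs_minus[of "x - y"] by simp

lemma cs_abs_diff: "\<bar>p x - p y\<bar> \<le> p (x - y)"
  using cs_add[of "x - y" y] cs_add[of "y - x" x] cs_diff_commute[of x y] by simp

lemma cs_adj: "p (free_adj x) = p x"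
proof -
  have le: "p y \<le> p (free_adj y)" for y
  proof (cases "p y = 0")
    case False
    then have "p y > 0" using cs_ge_0[of y] by linarith
    moreover have "p y * p y \<le> p (free_adj y) * p y"
      using cs_mult[of "free_adj y" y] cs_star[of y] by (simp add: power2_eq_square)
    ultimately show ?thesis by simp
  qed (simp add: cs_ge_0)
  show ?thesis using le[of x] le[of "free_adj x"] by simp
qed

lemma cs_1: "p 1 \<le> 1"
proof -
  have "p 1 = p 1 * p 1" using cs_star[of 1] by (simp add: power2_eq_square)
  then show ?thesis by (metis cs_ge_0 mult_cancel_left2 order.refl zero_le_one)
qed

lemma cs_contraction:
  assumes "p (free_adj x * x - 1) = 0"
  shows "p x \<le> 1"
proof -
  have "(p x)\<^sup>2 \<le> 1"
    using cs_add[of "free_adj x * x - 1" 1] cs_1 assms by (simp add: cs_star)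
  then show ?thesis using cs_ge_0[of x] by (simp add: abs_square_le_1)
qed

end

lemma admissible_cs: "p \<in> admissible \<Longrightarrow> cstar_seminorm p"
  by (simp add: admissible_def)

lemma free_adj_letter: "free_adj (letter g b) = letter g (\<not> b)"
  by (simp add: free_adj_single word_adj_def)

lemma admissible_letter:
  assumes "p \<in> admissible"
  shows "p (letter g b) \<le> 1"
proof -
  note cs = admissible_cs[OF assms]
  have "p free_U \<le> 1" "p free_S \<le> 1"
    using assms by (auto intro!: cs_contraction[OF cs] simp: admissible_def relators_def Let_def)
  then have "p (letter g False) \<le> 1" by (cases g) (simp_all add: free_U_def free_S_def)
  moreover have "p (letter g True) = p (letter g False)"
    using cs_adj[OF cs, of "letter g False"] by (simp add: free_adj_letter)
  ultimately show ?thesis by (cases b) simp_all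
qed

lemma admissible_word:
  assumes "p \<in> admissible"
  shows "p (Poly_Mapping.single (Word l) 1) \<le> 1"
proof (induction l)
  case Nil
  have "Poly_Mapping.single (Word []) 1 = (1::free_alg)" by (simp flip: zero_word_def)
  then show ?case using cs_1[OF admissible_cs[OF assms]] by simp
next
  case (Cons a l)
  obtain g b where a: "a = (g, b)" by force
  have "(Poly_Mapping.single (Word (a # l)) 1 :: free_alg) = letter g b * Poly_Mapping.single (Word l) 1"
    by (simp add: a mult_single plus_word_def)
  also have "p \<dots> \<le> p (letter g b) * p (Poly_Mapping.single (Word l) 1)"
    by (rule cs_mult[OF admissible_cs[OF assms]])
  also have "\<dots> \<le> 1"
    using Cons admissible_letter[OF assms, of g b]
    by (intro mult_le_one) (auto simp: cs_ge_0[OF admissible_cs[OF assms]])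
  finally show ?case .
qed

lemma admissible_bounded: "\<exists>B. \<forall>p\<in>admissible. p x \<le> B"
proof (induction x rule: free_induct)
  case (single w c)
  have "p (Poly_Mapping.single w c) \<le> cmod c" if "p \<in> admissible" for p
  proof -
    have "p (Poly_Mapping.single w c) = cmod c * p (Poly_Mapping.single w 1)"
      using cs_scale[OF admissible_cs[OF that], of c "Poly_Mapping.single w 1"]
      by (simp add: free_scale_single)
    also have "\<dots> \<le> cmod c * 1"
      using admissible_word[OF that, of "letters w"] by (intro mult_left_mono) auto
    finally show ?thesis by simp
  qed
  then show ?case by blast
next
  case (add x y)
  then obtain B C where "\<forall>p\<in>admissible. p x \<le> B" "\<forall>p\<in>admissible. p y \<le> C" by blast
  then have "\<forall>p\<in>admissible. p (x + y) \<le> B + C"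
    using cs_add[OF admissible_cs] by (meson add_mono order_trans)
  then show ?case by blast
qed

lemma admissible_bdd: "bdd_above ((\<lambda>p. p x) ` admissible)"
  using admissible_bounded[of x] by (auto simp: bdd_above_def)

lemma admissible_ne: "admissible \<noteq> {}"
proof -
  have "(\<lambda>_. 0) \<in> admissible" by (simp add: admissible_def cstar_seminorm_def)
  then show ?thesis by blast
qed

lemma admissible_le: "p \<in> admissible \<Longrightarrow> p x \<le> univ_norm x"
  unfolding univ_norm_def by (rule cSUP_upper[OF _ admissible_bdd])

lemma univ_norm_least: "(\<And>p. p \<in> admissible \<Longrightarrow> p x \<le> B) \<Longrightarrow> univ_norm x \<le> B"
  unfolding univ_norm_def by (rule cSUP_least[OF admissible_ne])

lemma univ_norm_ge_0: "univ_norm x \<ge> 0"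
proof -
  obtain p where p: "p \<in> admissible" using admissible_ne by blast
  show ?thesis using admissible_le[OF p, of x] cs_ge_0[OF admissible_cs[OF p], of x] by linarith
qed

lemma univ_norm_admissible: "univ_norm \<in> admissible"
proof -
  have "univ_norm (x + y) \<le> univ_norm x + univ_norm y" for x y
  proof (rule univ_norm_least)
    fix p assume p: "p \<in> admissible"
    show "p (x + y) \<le> univ_norm x + univ_norm y"
      using cs_add[OF admissible_cs[OF p], of x y] admissible_le[OF p, of x] admissible_le[OF p, of y]
      by linarith
  qed
  moreover have "univ_norm (x * y) \<le> univ_norm x * univ_norm y" for x y
  proof (rule univ_norm_least)
    fix p assume p: "p \<in> admissible"
    have "p x * p y \<le> univ_norm x * univ_norm y"
      by (intro mult_mono admissible_le p univ_norm_ge_0 cs_ge_0[OF admissible_cs])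
    then show "p (x * y) \<le> univ_norm x * univ_norm y"
      using cs_mult[OF admissible_cs[OF p], of x y] by linarith
  qed
  moreover have scale_le: "univ_norm (free_scale c x) \<le> cmod c * univ_norm x" for c x
    by (rule univ_norm_least) (simp add: cs_scale[OF admissible_cs] mult_left_mono admissible_le)
  moreover have "univ_norm (free_scale c x) = cmod c * univ_norm x" for c x
  proof (cases "c = 0")
    case True
    then show ?thesis using scale_le[of c x] univ_norm_ge_0[of "free_scale c x"] by simp
  next
    case False
    have "univ_norm x \<le> cmod (inverse c) * univ_norm (free_scale c x)"
      using scale_le[of "inverse c" "free_scale c x"] False by (simp add: free_scale_scale)
    then have "cmod c * univ_norm x \<le> cmod c * (cmod (inverse c) * univ_norm (free_scale c x))"
      by (rule mult_left_mono) simp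
    also have "\<dots> = univ_norm (free_scale c x)"
      using False by (simp add: norm_inverse)
    finally have "cmod c * univ_norm x \<le> univ_norm (free_scale c x)" .
    then show ?thesis using scale_le[of c x] by linarith
  qed
  moreover have "univ_norm (free_adj x * x) = (univ_norm x)\<^sup>2" for x
  proof (rule antisym)
    show "univ_norm (free_adj x * x) \<le> (univ_norm x)\<^sup>2"
      by (rule univ_norm_least)
        (simp add: cs_star[OF admissible_cs] power_mono admissible_le cs_ge_0[OF admissible_cs])
    have "univ_norm x \<le> sqrt (univ_norm (free_adj x * x))"
    proof (rule univ_norm_least)
      fix p assume p: "p \<in> admissible"
      have "(p x)\<^sup>2 \<le> univ_norm (free_adj x * x)"
        using admissible_le[OF p, of "free_adj x * x"] by (simp add: cs_star[OF admissible_cs[OF p]])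
      then show "p x \<le> sqrt (univ_norm (free_adj x * x))"
        by (rule real_le_rsqrt)
    qed
    then show "(univ_norm x)\<^sup>2 \<le> univ_norm (free_adj x * x)"
      using univ_norm_ge_0 by (metis power_mono real_sqrt_pow2)
  qed
  moreover have "univ_norm r = 0" if "r \<in> relators" for r
  proof (rule antisym)
    show "univ_norm r \<le> 0"
      using that by (intro univ_norm_least) (simp add: admissible_def)
  qed (rule univ_norm_ge_0)
  ultimately show ?thesis
    unfolding admissible_def cstar_seminorm_def by blast
qed

lemmas un_cs = admissible_cs[OF univ_norm_admissible]
lemmas un_add = cs_add[OF un_cs] and un_scale = cs_scale[OF un_cs] and un_mult = cs_mult[OF un_cs]
  and un_star = cs_star[OF un_cs] and un_0 = cs_0[OF un_cs] and un_adj = cs_adj[OF un_cs]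
  and un_diff_commute = cs_diff_commute[OF un_cs] and un_abs_diff = cs_abs_diff[OF un_cs]
  and un_diff = cs_diff[OF un_cs]

lemma un_triangle: "univ_norm (x - z) \<le> univ_norm (x - y) + univ_norm (y - z)"
  using un_add[of "x - y" "y - z"] by simp

lemma un_add_diff: "univ_norm ((x + y) - (x' + y')) \<le> univ_norm (x - x') + univ_norm (y - y')"
  using un_add[of "x - x'" "y - y'"] by (simp add: algebra_simps)

lemma un_mult_diff:
  "univ_norm (x * y - x' * y') \<le> univ_norm x * univ_norm (y - y') + univ_norm (x - x') * univ_norm y'"
proof -
  have "x * y - x' * y' = x * (y - y') + (x - x') * y'" by (simp add: algebra_simps)
  then show ?thesis
    using un_add[of "x * (y - y')" "(x - x') * y'"] un_mult[of x "y - y'"] un_mult[of "x - x'" y']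
    by simp
qed

section \<open>The 2-adic ring \<open>C\<^sup>*\<close>-algebra\<close>

definition un_Cauchy :: "(nat \<Rightarrow> free_alg) \<Rightarrow> bool" where
  "un_Cauchy X \<longleftrightarrow> (\<forall>e>0. \<exists>N. \<forall>m\<ge>N. \<forall>n\<ge>N. univ_norm (X m - X n) < e)"

definition un_equiv :: "(nat \<Rightarrow> free_alg) \<Rightarrow> (nat \<Rightarrow> free_alg) \<Rightarrow> bool" where
  "un_equiv X Y \<longleftrightarrow> un_Cauchy X \<and> un_Cauchy Y \<and> (\<lambda>n. univ_norm (X n - Y n)) \<longlonglongrightarrow> 0"

lemma un_null_squeeze:
  assumes "Z \<longlonglongrightarrow> (0::real)" "\<And>n. univ_norm (W n) \<le> Z n"
  shows "(\<lambda>n. univ_norm (W n)) \<longlonglongrightarrow> 0"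
  by (rule tendsto_sandwich[OF _ _ tendsto_const assms(1)]) (auto simp: univ_norm_ge_0 assms(2))

lemma un_Cauchy_const: "un_Cauchy (\<lambda>_. x)"
  by (simp add: un_Cauchy_def un_0)

lemma un_equiv_refl: "un_Cauchy X \<Longrightarrow> un_equiv X X"
  by (simp add: un_equiv_def un_0)

lemma un_equiv_const: "un_equiv (\<lambda>_. x) (\<lambda>_. x)"
  by (simp add: un_equiv_refl un_Cauchy_const)

lemma un_equiv_part_equivp: "part_equivp un_equiv"
proof (rule part_equivpI)
  show "\<exists>x. un_equiv x x" using un_equiv_const by blast
  show "symp un_equiv" by (auto simp: symp_def un_equiv_def un_diff_commute)
  show "transp un_equiv"
  proof (rule transpI)
    fix X Y Z assume *: "un_equiv X Y" "un_equiv Y Z"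
    have "(\<lambda>n. univ_norm (X n - Y n) + univ_norm (Y n - Z n)) \<longlonglongrightarrow> 0 + 0"
      using * unfolding un_equiv_def by (intro tendsto_add) auto
    then have "(\<lambda>n. univ_norm (X n - Z n)) \<longlonglongrightarrow> 0"
      by (intro un_null_squeeze[where Z = "\<lambda>n. univ_norm (X n - Y n) + univ_norm (Y n - Z n)"])
        (auto intro: un_triangle)
    with * show "un_equiv X Z" by (simp add: un_equiv_def)
  qed
qed

text \<open>
  The separated completion of the free unital \<open>*\<close>-algebra with respect to the universal
  seminorm, as Cauchy sequences modulo null sequences.
\<close>

lifting_forget poly_mapping.lifting

quotient_type Q2 = "nat \<Rightarrow> free_alg" / partial: un_equiv
  by (rule un_equiv_part_equivp)

lemma un_Cauchy_real: "un_Cauchy X \<Longrightarrow> Cauchy (\<lambda>n. univ_norm (X n))"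
  unfolding un_Cauchy_def Cauchy_def dist_real_def
  by (meson le_less_trans un_abs_diff)

lemma un_Cauchy_lim: "un_Cauchy X \<Longrightarrow> (\<lambda>n. univ_norm (X n)) \<longlonglongrightarrow> lim (\<lambda>n. univ_norm (X n))"
  using un_Cauchy_real Cauchy_convergent convergent_LIMSEQ_iff by blast

lemma un_Cauchy_bounded:
  assumes "un_Cauchy X" obtains B where "B > 0" "\<And>n. univ_norm (X n) \<le> B"
proof -
  have "Bseq (\<lambda>n. univ_norm (X n))"
    using un_Cauchy_lim[OF assms] by (meson Bseq_def convergentI convergent_imp_Bseq)
  then show ?thesis
    using that by (auto simp: Bseq_def abs_of_nonneg univ_norm_ge_0)
qed

lemma un_Cauchy_map:
  assumes "un_Cauchy X" "\<And>x y. univ_norm (f x - f y) \<le> K * univ_norm (x - y)" "K > 0"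
  shows "un_Cauchy (\<lambda>n. f (X n))"
  unfolding un_Cauchy_def
proof (intro allI impI)
  fix e :: real assume "e > 0"
  then obtain N where N: "\<forall>m\<ge>N. \<forall>n\<ge>N. univ_norm (X m - X n) < e / K"
    using assms(1,3) unfolding un_Cauchy_def by (meson divide_pos_pos)
  have "univ_norm (f (X m) - f (X n)) < e" if "m \<ge> N" "n \<ge> N" for m n
  proof -
    have "univ_norm (X m - X n) < e / K" using N that by blast
    then have "K * univ_norm (X m - X n) < e" using assms(3) by (simp add: field_simps)
    then show ?thesis using assms(2)[of "X m" "X n"] by linarith
  qed
  then show "\<exists>N. \<forall>m\<ge>N. \<forall>n\<ge>N. univ_norm (f (X m) - f (X n)) < e" by blast
qed

lemma un_equiv_map:
  assumes "un_equiv X Y" "\<And>x y. univ_norm (f x - f y) \<le> K * univ_norm (x - y)" "K > 0"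
  shows "un_equiv (\<lambda>n. f (X n)) (\<lambda>n. f (Y n))"
proof -
  have "(\<lambda>n. K * univ_norm (X n - Y n)) \<longlonglongrightarrow> K * 0"
    using assms(1) unfolding un_equiv_def by (intro tendsto_mult_left) auto
  then have "(\<lambda>n. univ_norm (f (X n) - f (Y n))) \<longlonglongrightarrow> 0"
    by (intro un_null_squeeze[where Z = "\<lambda>n. K * univ_norm (X n - Y n)"]) (auto intro: assms(2))
  moreover have "un_Cauchy (\<lambda>n. f (X n))" "un_Cauchy (\<lambda>n. f (Y n))"
    using assms(1) by (auto simp: un_equiv_def intro: un_Cauchy_map[OF _ assms(2,3)])
  ultimately show ?thesis unfolding un_equiv_def by blast
qed

lemma un_Cauchy_add:
  assumes "un_Cauchy X" "un_Cauchy Y"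
  shows "un_Cauchy (\<lambda>n. X n + Y n)"
  unfolding un_Cauchy_def
proof (intro allI impI)
  fix e :: real assume "e > 0"
  then obtain M N where MN: "\<forall>m\<ge>M. \<forall>n\<ge>M. univ_norm (X m - X n) < e / 2"
     "\<forall>m\<ge>N. \<forall>n\<ge>N. univ_norm (Y m - Y n) < e / 2"
    using assms unfolding un_Cauchy_def by (meson half_gt_zero)
  have "univ_norm ((X m + Y m) - (X n + Y n)) < e" if "m \<ge> max M N" "n \<ge> max M N" for m n
  proof -
    have "univ_norm (X m - X n) < e / 2" "univ_norm (Y m - Y n) < e / 2" using MN that by auto
    then show ?thesis using un_add_diff[of "X m" "Y m" "X n" "Y n"] by linarith
  qed
  then show "\<exists>N. \<forall>m\<ge>N. \<forall>n\<ge>N. univ_norm ((X m + Y m) - (X n + Y n)) < e" by blast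
qed

lemma un_equiv_add:
  assumes "un_equiv X X'" "un_equiv Y Y'"
  shows "un_equiv (\<lambda>n. X n + Y n) (\<lambda>n. X' n + Y' n)"
proof -
  have "(\<lambda>n. univ_norm (X n - X' n) + univ_norm (Y n - Y' n)) \<longlonglongrightarrow> 0 + 0"
    using assms unfolding un_equiv_def by (intro tendsto_add) auto
  then have "(\<lambda>n. univ_norm ((X n + Y n) - (X' n + Y' n))) \<longlonglongrightarrow> 0"
    by (intro un_null_squeeze[where Z = "\<lambda>n. univ_norm (X n - X' n) + univ_norm (Y n - Y' n)"])
      (auto intro: un_add_diff)
  then show ?thesis using assms by (simp add: un_equiv_def un_Cauchy_add)
qed

lemma un_Cauchy_mult:
  assumes "un_Cauchy X" "un_Cauchy Y"
  shows "un_Cauchy (\<lambda>n. X n * Y n)"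
  unfolding un_Cauchy_def
proof (intro allI impI)
  fix e :: real assume e: "e > 0"
  obtain B C where B: "B > 0" "\<And>n. univ_norm (X n) \<le> B" and C: "C > 0" "\<And>n. univ_norm (Y n) \<le> C"
    using assms un_Cauchy_bounded by metis
  obtain M N where MN: "\<forall>m\<ge>M. \<forall>n\<ge>M. univ_norm (X m - X n) < e / (2 * C)"
     "\<forall>m\<ge>N. \<forall>n\<ge>N. univ_norm (Y m - Y n) < e / (2 * B)"
    using assms e B(1) C(1) unfolding un_Cauchy_def
    by (metis divide_pos_pos mult_pos_pos zero_less_numeral)
  have "univ_norm (X m * Y m - X n * Y n) < e" if "m \<ge> max M N" "n \<ge> max M N" for m n
  proof -
    have 1: "univ_norm (X m - X n) < e / (2 * C)" "univ_norm (Y m - Y n) < e / (2 * B)"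
      using MN that by auto
    have "univ_norm (X m) * univ_norm (Y m - Y n) \<le> B * univ_norm (Y m - Y n)"
      by (intro mult_right_mono B univ_norm_ge_0)
    moreover have "B * univ_norm (Y m - Y n) < e / 2"
      using 1(2) B(1) by (simp add: field_simps)
    moreover have "univ_norm (X m - X n) * univ_norm (Y n) \<le> univ_norm (X m - X n) * C"
      by (intro mult_left_mono C univ_norm_ge_0)
    moreover have "univ_norm (X m - X n) * C < e / 2"
      using 1(1) C(1) by (simp add: field_simps)
    ultimately show ?thesis
      using un_mult_diff[of "X m" "Y m" "X n" "Y n"] by linarith
  qed
  then show "\<exists>N. \<forall>m\<ge>N. \<forall>n\<ge>N. univ_norm (X m * Y m - X n * Y n) < e" by blast
qed

lemma un_equiv_mult:
  assumes "un_equiv X X'" "un_equiv Y Y'"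
  shows "un_equiv (\<lambda>n. X n * Y n) (\<lambda>n. X' n * Y' n)"
proof -
  obtain B C where B: "\<And>n. univ_norm (X n) \<le> B" and C: "\<And>n. univ_norm (Y' n) \<le> C"
    using assms un_Cauchy_bounded unfolding un_equiv_def by metis
  have "(\<lambda>n. B * univ_norm (Y n - Y' n) + univ_norm (X n - X' n) * C) \<longlonglongrightarrow> B * 0 + 0 * C"
    using assms unfolding un_equiv_def by (intro tendsto_intros) auto
  moreover have "univ_norm (X n * Y n - X' n * Y' n)
      \<le> B * univ_norm (Y n - Y' n) + univ_norm (X n - X' n) * C" for n
    by (rule order_trans[OF un_mult_diff]) (intro add_mono mult_mono B C univ_norm_ge_0 order.refl
        order_trans[OF univ_norm_ge_0 B] order_trans[OF univ_norm_ge_0 C])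
  ultimately have "(\<lambda>n. univ_norm (X n * Y n - X' n * Y' n)) \<longlonglongrightarrow> 0"
    by (intro un_null_squeeze[where Z = "\<lambda>n. B * univ_norm (Y n - Y' n) + univ_norm (X n - X' n) * C"])
      auto
  then show ?thesis using assms by (simp add: un_equiv_def un_Cauchy_mult)
qed

lemma un_equiv_scale:
  assumes "un_equiv X Y"
  shows "un_equiv (\<lambda>n. free_scale c (X n)) (\<lambda>n. free_scale c (Y n))"
proof (rule un_equiv_map[OF assms, of "free_scale c" "cmod c + 1"])
  fix x y
  have "cmod c * univ_norm (x - y) \<le> (cmod c + 1) * univ_norm (x - y)"
    by (intro mult_right_mono univ_norm_ge_0) simp
  then show "univ_norm (free_scale c x - free_scale c y) \<le> (cmod c + 1) * univ_norm (x - y)"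
    by (simp only: un_scale flip: free_scale_diff)
qed (simp add: add_nonneg_pos)

lemma un_equiv_minus: "un_equiv X Y \<Longrightarrow> un_equiv (\<lambda>n. - X n) (\<lambda>n. - Y n)"
  using un_equiv_scale[of X Y "-1"] by (simp only: free_scale_minus_one)

lemma un_equiv_diff:
  "un_equiv X X' \<Longrightarrow> un_equiv Y Y' \<Longrightarrow> un_equiv (\<lambda>n. X n - Y n) (\<lambda>n. X' n - Y' n)"
  using un_equiv_add[OF _ un_equiv_minus, of X X' Y Y'] by (simp only: diff_conv_add_uminus)

lemma un_equiv_adj:
  assumes "un_equiv X Y"
  shows "un_equiv (\<lambda>n. free_adj (X n)) (\<lambda>n. free_adj (Y n))"
  by (rule un_equiv_map[OF assms, of free_adj 1]) (simp_all add: un_adj flip: free_adj_diff)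

lemma un_equiv_lim:
  assumes "un_equiv X Y"
  shows "lim (\<lambda>n. univ_norm (X n)) = lim (\<lambda>n. univ_norm (Y n))"
proof -
  have "un_Cauchy X" "un_Cauchy Y" and null: "(\<lambda>n. univ_norm (X n - Y n)) \<longlonglongrightarrow> 0"
    using assms by (simp_all add: un_equiv_def)
  note X = un_Cauchy_lim[OF this(1)] and Y = un_Cauchy_lim[OF this(2)]
  have "(\<lambda>n. univ_norm (X n) - univ_norm (Y n)) \<longlonglongrightarrow> 0"
    by (rule Lim_null_comparison[OF _ null]) (simp add: un_abs_diff)
  from LIMSEQ_unique[OF this tendsto_diff[OF X Y]] show ?thesis by simp
qed

lemma un_equiv_lim': "un_equiv X X \<Longrightarrow> (\<lambda>n. univ_norm (X n)) \<longlonglongrightarrow> lim (\<lambda>n. univ_norm (X n))"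
  unfolding un_equiv_def by (blast intro: un_Cauchy_lim)

lift_definition free_to_Q2 :: "free_alg \<Rightarrow> Q2" is "\<lambda>x _. x"
  by (rule un_equiv_const)

lemmas un_equiv_intros = un_equiv_add un_equiv_mult un_equiv_diff un_equiv_minus un_equiv_scale
  un_equiv_adj un_equiv_const

instantiation Q2 :: "{real_normed_algebra, monoid_mult, scaleC, adjoint}"
begin

lift_definition zero_Q2 :: Q2 is "\<lambda>_. 0" by (rule un_equiv_const)
lift_definition one_Q2 :: Q2 is "\<lambda>_. 1" by (rule un_equiv_const)
lift_definition plus_Q2 :: "Q2 \<Rightarrow> Q2 \<Rightarrow> Q2" is "\<lambda>X Y n. X n + Y n" by (rule un_equiv_add)
lift_definition minus_Q2 :: "Q2 \<Rightarrow> Q2 \<Rightarrow> Q2" is "\<lambda>X Y n. X n - Y n" by (rule un_equiv_diff)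
lift_definition uminus_Q2 :: "Q2 \<Rightarrow> Q2" is "\<lambda>X n. - X n" by (rule un_equiv_minus)
lift_definition times_Q2 :: "Q2 \<Rightarrow> Q2 \<Rightarrow> Q2" is "\<lambda>X Y n. X n * Y n" by (rule un_equiv_mult)
lift_definition scaleC_Q2 :: "complex \<Rightarrow> Q2 \<Rightarrow> Q2" is "\<lambda>c X n. free_scale c (X n)"
  by (rule un_equiv_scale)
lift_definition adj_Q2 :: "Q2 \<Rightarrow> Q2" is "\<lambda>X n. free_adj (X n)" by (rule un_equiv_adj)
lift_definition norm_Q2 :: "Q2 \<Rightarrow> real" is "\<lambda>X. lim (\<lambda>n. univ_norm (X n))" by (rule un_equiv_lim)

definition scaleR_Q2 :: "real \<Rightarrow> Q2 \<Rightarrow> Q2" where "scaleR_Q2 r x = complex_of_real r *\<^sub>C x"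
definition sgn_Q2 :: "Q2 \<Rightarrow> Q2" where "sgn_Q2 x = inverse (norm x) *\<^sub>R x"
definition dist_Q2 :: "Q2 \<Rightarrow> Q2 \<Rightarrow> real" where "dist_Q2 x y = norm (x - y)"
definition uniformity_Q2 :: "(Q2 \<times> Q2) filter" where
  "uniformity_Q2 = (INF e\<in>{0<..}. principal {(x, y). dist x y < e})"
definition open_Q2 :: "Q2 set \<Rightarrow> bool" where
  "open_Q2 A \<longleftrightarrow> (\<forall>x\<in>A. eventually (\<lambda>(x', y). x' = x \<longrightarrow> y \<in> A) uniformity)"

instance
proof
  fix a b c :: Q2
  show "a + b + c = a + (b + c)" by transfer (simp only: add.assoc, intro un_equiv_intros)
  show "a + b = b + a" by transfer (subst add.commute, intro un_equiv_intros)
  show "0 + a = a" by transfer simp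
  show "- a + a = 0" by transfer (simp add: un_equiv_const)
  show "a - b = a + - b"
    by transfer (simp only: diff_conv_add_uminus, intro un_equiv_intros)
  show "a * b * c = a * (b * c)"
    by transfer (simp only: mult.assoc, intro un_equiv_intros)
  show "(a + b) * c = a * c + b * c"
    by transfer (simp only: distrib_right, intro un_equiv_intros)
  show "a * (b + c) = a * b + a * c"
    by transfer (simp only: distrib_left, intro un_equiv_intros)
  show "1 * a = a" by transfer simp
  show "a * 1 = a" by transfer simp
next
  fix a b :: real and c :: complex and x y :: Q2
  show "a *\<^sub>R (x + y) = a *\<^sub>R x + a *\<^sub>R y"
    unfolding scaleR_Q2_def by transfer (simp only: free_scale_add, intro un_equiv_intros)
  show "(a + b) *\<^sub>R x = a *\<^sub>R x + b *\<^sub>R x"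
    unfolding scaleR_Q2_def by transfer (simp only: free_scale_add_left of_real_add, intro un_equiv_intros)
  show "a *\<^sub>R b *\<^sub>R x = (a * b) *\<^sub>R x"
    unfolding scaleR_Q2_def by transfer (simp only: free_scale_scale of_real_mult, intro un_equiv_intros)
  show "1 *\<^sub>R x = x"
    unfolding scaleR_Q2_def by transfer simp
  show "(a *\<^sub>R x) * y = a *\<^sub>R (x * y)"
    unfolding scaleR_Q2_def by transfer (simp only: free_scale_mult_left, intro un_equiv_intros)
  show "x * (a *\<^sub>R y) = a *\<^sub>R (x * y)"
    unfolding scaleR_Q2_def by transfer (simp only: free_scale_mult_right, intro un_equiv_intros)
  show "dist x y = norm (x - y)" by (rule dist_Q2_def)
  show "sgn x = inverse (norm x) *\<^sub>R x" by (rule sgn_Q2_def)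
  show "uniformity = (INF e\<in>{0<..}. principal {(x::Q2, y). dist x y < e})"
    by (rule uniformity_Q2_def)
  show "open A \<longleftrightarrow> (\<forall>x\<in>A. eventually (\<lambda>(x', y). x' = x \<longrightarrow> y \<in> A) uniformity)" for A :: "Q2 set"
    by (rule open_Q2_def)
  show "norm x = 0 \<longleftrightarrow> x = 0"
  proof transfer
    fix X assume X: "un_equiv X X"
    have "(\<lambda>n. univ_norm (X n)) \<longlonglongrightarrow> 0 \<longleftrightarrow> lim (\<lambda>n. univ_norm (X n)) = 0"
      using un_equiv_lim'[OF X] by (auto intro: limI)
    with X show "lim (\<lambda>n. univ_norm (X n)) = 0 \<longleftrightarrow> un_equiv X (\<lambda>_. 0)"
      by (auto simp: un_equiv_def un_Cauchy_const)
  qed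
  show "norm (x + y) \<le> norm x + norm y"
  proof transfer
    fix X Y assume "un_equiv X X" "un_equiv Y Y"
    then show "lim (\<lambda>n. univ_norm (X n + Y n)) \<le> lim (\<lambda>n. univ_norm (X n)) + lim (\<lambda>n. univ_norm (Y n))"
      by (intro LIMSEQ_le[OF un_equiv_lim' tendsto_add[OF un_equiv_lim' un_equiv_lim']])
        (auto simp: un_add un_equiv_add)
  qed
  show "norm (x * y) \<le> norm x * norm y"
  proof transfer
    fix X Y assume "un_equiv X X" "un_equiv Y Y"
    then show "lim (\<lambda>n. univ_norm (X n * Y n)) \<le> lim (\<lambda>n. univ_norm (X n)) * lim (\<lambda>n. univ_norm (Y n))"
      by (intro LIMSEQ_le[OF un_equiv_lim' tendsto_mult[OF un_equiv_lim' un_equiv_lim']])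
        (auto simp: un_mult un_equiv_mult)
  qed
  show "norm (a *\<^sub>R x) = \<bar>a\<bar> * norm x"
    unfolding scaleR_Q2_def
  proof transfer
    fix a :: real and X assume "un_equiv X X"
    then show "lim (\<lambda>n. univ_norm (free_scale (complex_of_real a) (X n))) = \<bar>a\<bar> * lim (\<lambda>n. univ_norm (X n))"
      by (intro limI) (auto simp: un_scale intro!: tendsto_mult_left un_equiv_lim')
  qed
qed

end

lemma norm_free_to_Q2: "norm (free_to_Q2 x) = univ_norm x"
  by transfer simp

lemma free_to_Q2_add: "free_to_Q2 (x + y) = free_to_Q2 x + free_to_Q2 y"
  by transfer (rule un_equiv_const)
lemma free_to_Q2_diff: "free_to_Q2 (x - y) = free_to_Q2 x - free_to_Q2 y"
  by transfer (rule un_equiv_const)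
lemma free_to_Q2_mult: "free_to_Q2 (x * y) = free_to_Q2 x * free_to_Q2 y"
  by transfer (rule un_equiv_const)
lemma free_to_Q2_scale: "free_to_Q2 (free_scale c x) = c *\<^sub>C free_to_Q2 x"
  by transfer (rule un_equiv_const)
lemma free_to_Q2_adj: "free_to_Q2 (free_adj x) = (free_to_Q2 x)\<^sup>\<star>"
  by transfer (rule un_equiv_const)
lemma free_to_Q2_1: "free_to_Q2 1 = 1"
  by transfer (rule un_equiv_const)

lemma Q2_approx_seq:
  assumes "un_equiv X X"
  shows "(\<lambda>k. free_to_Q2 (X k)) \<longlonglongrightarrow> abs_Q2 X"
proof (rule LIMSEQ_I)
  fix e :: real assume e: "e > 0"
  then obtain N where N: "\<forall>m\<ge>N. \<forall>n\<ge>N. univ_norm (X m - X n) < e / 2"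
    using assms unfolding un_equiv_def un_Cauchy_def by (meson half_gt_zero)
  have "norm (free_to_Q2 (X k) - abs_Q2 X) < e" if "k \<ge> N" for k
  proof -
    have eq: "un_equiv (\<lambda>n. X k - X n) (\<lambda>n. X k - X n)"
      by (intro un_equiv_diff un_equiv_const assms)
    have "free_to_Q2 (X k) - abs_Q2 X = abs_Q2 (\<lambda>n. X k - X n)"
      unfolding free_to_Q2_def by (simp add: minus_Q2.abs_eq un_equiv_const assms)
    then have "norm (free_to_Q2 (X k) - abs_Q2 X) = lim (\<lambda>n. univ_norm (X k - X n))"
      using eq by (simp add: norm_Q2.abs_eq)
    also have "\<dots> \<le> e / 2"
      using N that by (intro LIMSEQ_le_const2[OF un_equiv_lim'[OF eq]]) (force intro: less_imp_le)
    finally show ?thesis using e by simp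
  qed
  then show "\<exists>N. \<forall>k\<ge>N. norm (free_to_Q2 (X k) - abs_Q2 X) < e" by blast
qed

lemma Q2_approx: 
  assumes "e > 0" obtains a where "norm (x - free_to_Q2 a) < e"
proof -
  obtain X where "un_equiv X X" "x = abs_Q2 X" by (metis Quotient3_Q2 Quotient3_abs_rep Quotient3_rep_reflp)
  then show ?thesis
    using LIMSEQ_D[OF Q2_approx_seq assms] that by (metis norm_minus_commute order.refl)
qed

lemma closure_free_to_Q2: "closure (range free_to_Q2) = UNIV"
  unfolding closure_approachable using Q2_approx
  by (metis (no_types, lifting) UNIV_I UNIV_eq_I closure_approachable dist_commute dist_norm rangeI)

instance Q2 :: unital_cstar_algebra
proof
  fix X :: "nat \<Rightarrow> Q2" assume X: "Cauchy X"
  have "\<exists>a. norm (X n - free_to_Q2 a) < inverse (real (Suc n))" for n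
    by (rule Q2_approx[of "inverse (real (Suc n))" "X n"]) auto
  then obtain A where A: "\<And>n. norm (X n - free_to_Q2 (A n)) < inverse (real (Suc n))" by metis
  have XA: "(\<lambda>n. X n - free_to_Q2 (A n)) \<longlonglongrightarrow> 0"
    by (rule Lim_null_comparison[OF _ LIMSEQ_inverse_real_of_nat])
      (intro always_eventually allI less_imp_le A)
  have "Cauchy (\<lambda>n. free_to_Q2 (A n))"
  proof (rule metric_CauchyI)
    fix e :: real assume e: "e > 0"
    obtain M where M: "\<And>m n. m \<ge> M \<Longrightarrow> n \<ge> M \<Longrightarrow> norm (X m - X n) < e / 3"
      using metric_CauchyD[OF X, of "e / 3"] e by (auto simp: dist_norm)
    obtain N where N: "\<And>n. n \<ge> N \<Longrightarrow> norm (X n - free_to_Q2 (A n)) < e / 3"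
      using LIMSEQ_D[OF XA, of "e / 3"] e by auto
    have "dist (free_to_Q2 (A m)) (free_to_Q2 (A n)) < e" if "m \<ge> max M N" "n \<ge> max M N" for m n
    proof -
      have "norm (X m - X n) < e / 3" "norm (X m - free_to_Q2 (A m)) < e / 3"
        "norm (X n - free_to_Q2 (A n)) < e / 3" using M N that by auto
      moreover have eq: "free_to_Q2 (A m) - free_to_Q2 (A n)
          = (X m - X n) - (X m - free_to_Q2 (A m)) + (X n - free_to_Q2 (A n))" by simp
      ultimately show ?thesis
        unfolding dist_norm eq
        using norm_triangle_ineq[of "(X m - X n) - (X m - free_to_Q2 (A m))" "X n - free_to_Q2 (A n)"]
          norm_triangle_ineq4[of "X m - X n" "X m - free_to_Q2 (A m)"] by linarith
    qed
    then show "\<exists>N. \<forall>m\<ge>N. \<forall>n\<ge>N. dist (free_to_Q2 (A m)) (free_to_Q2 (A n)) < e" by blast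
  qed
  then have "un_Cauchy A"
    by (auto simp: un_Cauchy_def Cauchy_def dist_norm norm_free_to_Q2 simp flip: free_to_Q2_diff)
  then have "(\<lambda>n. free_to_Q2 (A n)) \<longlonglongrightarrow> abs_Q2 A"
    by (intro Q2_approx_seq un_equiv_refl)
  from tendsto_add[OF XA this] show "convergent X"
    by (auto simp: convergent_def)
next
  fix c d :: complex and r :: real and x y :: Q2
  show "c *\<^sub>C (x + y) = c *\<^sub>C x + c *\<^sub>C y"
    by transfer (simp only: free_scale_add, intro un_equiv_intros)
  show "(c + d) *\<^sub>C x = c *\<^sub>C x + d *\<^sub>C x"
    by transfer (simp only: free_scale_add_left of_real_add, intro un_equiv_intros)
  show "c *\<^sub>C d *\<^sub>C x = (c * d) *\<^sub>C x"
    by transfer (simp only: free_scale_scale of_real_mult, intro un_equiv_intros)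
  show "r *\<^sub>R x = complex_of_real r *\<^sub>C x"
    by (rule scaleR_Q2_def)
  show "(c *\<^sub>C x) * y = c *\<^sub>C (x * y)"
    by transfer (simp only: free_scale_mult_left, intro un_equiv_intros)
  show "x * (c *\<^sub>C y) = c *\<^sub>C (x * y)"
    by transfer (simp only: free_scale_mult_right, intro un_equiv_intros)
  show "norm (c *\<^sub>C x) = cmod c * norm x"
  proof transfer
    fix c :: complex and X assume "un_equiv X X"
    then show "lim (\<lambda>n. univ_norm (free_scale c (X n))) = cmod c * lim (\<lambda>n. univ_norm (X n))"
      by (intro limI) (auto simp: un_scale intro!: tendsto_mult_left un_equiv_lim')
  qed
  show "(x\<^sup>\<star>)\<^sup>\<star> = x" by transfer simp
  show "(x + y)\<^sup>\<star> = x\<^sup>\<star> + y\<^sup>\<star>"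
    by transfer (simp only: free_adj_add, intro un_equiv_intros)
  show "(c *\<^sub>C x)\<^sup>\<star> = cnj c *\<^sub>C x\<^sup>\<star>"
    by transfer (simp only: free_adj_scale, intro un_equiv_intros)
  show "(x * y)\<^sup>\<star> = y\<^sup>\<star> * x\<^sup>\<star>"
    by transfer (simp only: free_adj_mult, intro un_equiv_intros)
  show "norm (x\<^sup>\<star> * x) = (norm x)\<^sup>2"
  proof transfer
    fix X assume "un_equiv X X"
    then show "lim (\<lambda>n. univ_norm (free_adj (X n) * X n)) = (lim (\<lambda>n. univ_norm (X n)))\<^sup>2"
      by (intro limI) (auto simp: un_star intro!: tendsto_power un_equiv_lim')
  qed
qed

definition Q2_U :: Q2 where "Q2_U = free_to_Q2 free_U"
definition Q2_S :: Q2 where "Q2_S = free_to_Q2 free_S"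

lemma Q2_relations_generators: "Q2_relations Q2_U Q2_S"
proof -
  have "\<forall>r\<in>relators. free_to_Q2 r = 0"
    using univ_norm_admissible by (simp add: admissible_def flip: norm_free_to_Q2)
  then show ?thesis
    unfolding Q2_relations_def Q2_U_def Q2_S_def relators_def Let_def
    by (simp add: power2_eq_square free_to_Q2_add free_to_Q2_diff free_to_Q2_mult free_to_Q2_adj
        free_to_Q2_1)
qed

text \<open>
  The \<open>*\<close>-polynomials in the two generators are dense by \<open>closure_free_to_Q2\<close>; the universal
  property is \<open>Q2_universal\<close> below.
\<close>

lemma scaleC_one [simp]: "1 *\<^sub>C (x::'a::unital_cstar_algebra) = x"
  using scaleR_scaleC[of 1 x] by simp

lemma scaleC_zero [simp]: "0 *\<^sub>C (x::'a::unital_cstar_algebra) = 0"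
  using scaleR_scaleC[of 0 x] by simp

lemma scaleC_minus: "c *\<^sub>C (- x) = - (c *\<^sub>C (x::'a::unital_cstar_algebra))"
  using scaleC_add_right[of c x "-x"] scaleC_add_right[of c 0 "0::'a"] by (simp add: minus_unique)

lemma scaleC_diff: "c *\<^sub>C (x - y) = c *\<^sub>C x - c *\<^sub>C (y::'a::unital_cstar_algebra)"
  using scaleC_add_right[of c x "-y"] by (simp add: scaleC_minus)

lemma adj_one [simp]: "(1::'a::unital_cstar_algebra)\<^sup>\<star> = 1"
  using adj_mult[of "1::'a" "1\<^sup>\<star>"] by (simp add: adj_adj)

lemma adj_minus: "(- x)\<^sup>\<star> = - (x::'a::unital_cstar_algebra)\<^sup>\<star>"
  using adj_add[of x "-x"] adj_add[of "0::'a" 0] by (simp add: minus_unique)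

lemma adj_diff: "(x - y)\<^sup>\<star> = x\<^sup>\<star> - (y::'a::unital_cstar_algebra)\<^sup>\<star>"
  using adj_add[of x "-y"] by (simp add: adj_minus)

lemma norm_adj: "norm (x\<^sup>\<star>) = norm (x::'a::unital_cstar_algebra)"
proof -
  have le: "norm y \<le> norm (y\<^sup>\<star>)" for y :: 'a
  proof (cases "y = 0")
    case False
    have "norm y * norm y \<le> norm (y\<^sup>\<star>) * norm y"
      using norm_mult_ineq[of "y\<^sup>\<star>" y] by (simp add: cstar_identity power2_eq_square)
    with False show ?thesis by simp
  qed simp
  show ?thesis using le[of x] le[of "x\<^sup>\<star>"] by (simp add: adj_adj)
qed

lemma tendsto_adj:
  fixes l :: "'a::unital_cstar_algebra"
  assumes "(f \<longlongrightarrow> l) F"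
  shows "((\<lambda>x. (f x)\<^sup>\<star>) \<longlongrightarrow> l\<^sup>\<star>) F"
  using assms unfolding tendsto_iff dist_norm by (simp add: norm_adj flip: adj_diff)

lemma tendsto_scaleC:
  fixes l :: "'a::unital_cstar_algebra"
  assumes "(f \<longlongrightarrow> l) F"
  shows "((\<lambda>x. c *\<^sub>C f x) \<longlongrightarrow> c *\<^sub>C l) F"
proof -
  have "((\<lambda>x. cmod c * norm (f x - l)) \<longlongrightarrow> cmod c * norm (l - l)) F"
    by (intro tendsto_intros assms)
  then have "((\<lambda>x. norm (c *\<^sub>C f x - c *\<^sub>C l)) \<longlongrightarrow> 0) F"
    by (simp add: norm_scaleC flip: scaleC_diff)
  then show ?thesis
    by (metis LIM_zero_cancel tendsto_norm_zero_cancel)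
qed

fun eval_letter :: "'a::unital_cstar_algebra \<Rightarrow> 'a \<Rightarrow> generator \<times> bool \<Rightarrow> 'a" where
  "eval_letter u s (GU, b) = (if b then u\<^sup>\<star> else u)"
| "eval_letter u s (GS, b) = (if b then s\<^sup>\<star> else s)"

definition eval_word :: "'a::unital_cstar_algebra \<Rightarrow> 'a \<Rightarrow> word \<Rightarrow> 'a" where
  "eval_word u s w = prod_list (map (eval_letter u s) (letters w))"

definition free_eval :: "'a::unital_cstar_algebra \<Rightarrow> 'a \<Rightarrow> free_alg \<Rightarrow> 'a" where
  "free_eval u s a = (\<Sum>w\<in>Poly_Mapping.keys a. Poly_Mapping.lookup a w *\<^sub>C eval_word u s w)"

lemma eval_word_0 [simp]: "eval_word u s 0 = 1"
  by (simp add: eval_word_def zero_word_def)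

lemma eval_word_add: "eval_word u s (v + w) = eval_word u s v * eval_word u s w"
  by (simp add: eval_word_def plus_word_def)

lemma eval_word_adj: "eval_word u s (word_adj w) = (eval_word u s w)\<^sup>\<star>"
proof -
  have 1: "eval_letter u s (g, \<not> b) = (eval_letter u s (g, b))\<^sup>\<star>" for g b
    by (cases g) (simp_all add: adj_adj)
  have "prod_list (map (eval_letter u s) (rev (map (\<lambda>(g, b). (g, \<not> b)) l)))
      = (prod_list (map (eval_letter u s) l))\<^sup>\<star>" for l
    by (induction l) (auto simp: adj_mult 1 simp del: eval_letter.simps)
  then show ?thesis by (simp add: eval_word_def word_adj_def)
qed

lemma free_eval_single: "free_eval u s (Poly_Mapping.single w c) = c *\<^sub>C eval_word u s w"
  by (simp add: free_eval_def)

lemma free_eval_superset: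
  assumes "finite A" "Poly_Mapping.keys a \<subseteq> A"
  shows "free_eval u s a = (\<Sum>w\<in>A. Poly_Mapping.lookup a w *\<^sub>C eval_word u s w)"
  unfolding free_eval_def using assms
  by (intro sum.mono_neutral_left) (auto simp: in_keys_iff)

lemma free_eval_add: "free_eval u s (a + b) = free_eval u s a + free_eval u s b"
proof -
  let ?A = "Poly_Mapping.keys a \<union> Poly_Mapping.keys b"
  have "free_eval u s c = (\<Sum>w\<in>?A. Poly_Mapping.lookup c w *\<^sub>C eval_word u s w)"
    if "Poly_Mapping.keys c \<subseteq> ?A" for c
    using that by (intro free_eval_superset) auto
  then show ?thesis
    using Poly_Mapping.keys_add[of a b]
    by (simp add: lookup_add scaleC_add_left sum.distrib)
qed

lemma free_eval_mult: "free_eval u s (a * b) = free_eval u s a * free_eval u s b"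
proof (induction a rule: free_induct)
  case (single v c)
  show ?case
    by (induction b rule: free_induct)
      (simp_all add: mult_single free_eval_single eval_word_add free_eval_add distrib_left
        mult_scaleC_left mult_scaleC_right scaleC_scaleC mult.commute[of "_::complex"])
qed (simp add: distrib_right free_eval_add)

lemma free_eval_1 [simp]: "free_eval u s 1 = 1"
  using free_eval_single[of u s 0 1] by simp

lemma free_eval_scale: "free_eval u s (free_scale c a) = c *\<^sub>C free_eval u s a"
  by (simp add: free_scale_def free_eval_mult free_eval_single mult_scaleC_left)

lemma free_eval_diff: "free_eval u s (a - b) = free_eval u s a - free_eval u s b"
  using free_eval_add[of u s "a - b" b] by simp

lemma free_eval_adj: "free_eval u s (free_adj a) = (free_eval u s a)\<^sup>\<star>"
  by (induction a rule: free_induct)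
    (simp_all add: free_adj_single free_eval_single eval_word_adj adj_scaleC free_adj_add
      free_eval_add adj_add)

lemma free_eval_generators [simp]: "free_eval u s free_U = u" "free_eval u s free_S = s"
  by (simp_all add: free_U_def free_S_def free_eval_single eval_word_def)

lemma free_eval_bound:
  assumes "Q2_relations u s"
  shows "norm (free_eval u s a) \<le> univ_norm a"
proof -
  have "(\<lambda>a. norm (free_eval u s a)) \<in> admissible"
    using assms
    by (auto simp: admissible_def cstar_seminorm_def relators_def Let_def Q2_relations_def
        free_eval_add free_eval_mult free_eval_scale free_eval_adj free_eval_diff power2_eq_square
        norm_triangle_ineq norm_scaleC norm_mult_ineq cstar_identity[unfolded power2_eq_square])
  then show ?thesis by (rule admissible_le)
qed

lemma free_to_Q2_seq: obtains A where "(\<lambda>n. free_to_Q2 (A n)) \<longlonglongrightarrow> x"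
proof -
  obtain f where f: "\<And>n. f n \<in> range free_to_Q2" "f \<longlonglongrightarrow> x"
    using closure_free_to_Q2 closure_sequential[of x "range free_to_Q2"] by auto
  have "f n = free_to_Q2 (inv free_to_Q2 (f n))" for n
    using f(1)[of n] by (simp add: f_inv_into_f)
  then have "(\<lambda>n. free_to_Q2 (inv free_to_Q2 (f n))) \<longlonglongrightarrow> x"
    using f(2) by presburger
  then show ?thesis by (rule that)
qed

lemma free_to_Q2_letter: "free_to_Q2 (letter g b) = eval_letter Q2_U Q2_S (g, b)"
  using free_to_Q2_adj[of "letter g False"]
  by (cases g; cases b) (simp_all add: free_adj_letter Q2_U_def Q2_S_def free_U_def free_S_def)

lemma free_to_Q2_word: "free_to_Q2 (Poly_Mapping.single (Word l) 1) = eval_word Q2_U Q2_S (Word l)"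
proof (induction l)
  case Nil
  have "Poly_Mapping.single (Word []) 1 = (1::free_alg)"
    by (simp flip: zero_word_def)
  then show ?case by (simp add: eval_word_def free_to_Q2_1)
next
  case (Cons a l)
  obtain g b where a: "a = (g, b)" by force
  have "(Poly_Mapping.single (Word (a # l)) 1 :: free_alg) = letter g b * Poly_Mapping.single (Word l) 1"
    by (simp add: a mult_single plus_word_def)
  then have "free_to_Q2 (Poly_Mapping.single (Word (a # l)) 1)
      = free_to_Q2 (letter g b) * free_to_Q2 (Poly_Mapping.single (Word l) 1)"
    by (simp only: free_to_Q2_mult)
  also have "\<dots> = eval_word Q2_U Q2_S (Word (a # l))"
    unfolding Cons.IH free_to_Q2_letter by (simp add: eval_word_def a)
  finally show ?case .
qed

lemma free_to_Q2_eval: "free_to_Q2 a = free_eval Q2_U Q2_S a"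
proof (induction a rule: free_induct)
  case (single w c)
  show ?case
    using free_to_Q2_scale[of c "Poly_Mapping.single w 1"] free_to_Q2_word[of "letters w"]
    by (simp add: free_scale_single free_eval_single)
qed (simp add: free_to_Q2_add free_eval_add)

lemma free_eval_hom:
  assumes "unital_star_hom f"
  shows "f (free_eval u s a) = free_eval (f u) (f s) a"
proof (induction a rule: free_induct)
  case (single w c)
  have f: "f (x * y) = f x * f y" "f (x\<^sup>\<star>) = (f x)\<^sup>\<star>" "f 1 = 1" "f (c *\<^sub>C x) = c *\<^sub>C f x" for x y
    using assms by (auto simp: unital_star_hom_def)
  have "f (eval_letter u s x) = eval_letter (f u) (f s) x" for x
    by (cases x; cases "fst x") (auto simp: f)
  then have "f (prod_list (map (eval_letter u s) l)) = prod_list (map (eval_letter (f u) (f s)) l)" for l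
    by (induction l) (simp_all add: f)
  then show ?case by (simp add: free_eval_single eval_word_def f)
next
  case (add a b)
  then show ?case using assms by (simp add: free_eval_add unital_star_hom_def)
qed

theorem Q2_universal:
  fixes u s :: "'a::unital_cstar_algebra"
  assumes rel: "Q2_relations u s"
  shows "\<exists>!f. unital_star_hom f \<and> continuous_on UNIV f \<and> f Q2_U = u \<and> f Q2_S = s"
proof (rule ex_ex1I)
  let ?E = "free_eval u s"
  have bound: "norm (?E a - ?E b) \<le> norm (free_to_Q2 a - free_to_Q2 b)" for a b
    using free_eval_bound[OF rel, of "a - b"]
    by (simp add: free_eval_diff norm_free_to_Q2 flip: free_to_Q2_diff)
  have "\<exists>y. \<forall>A. (\<lambda>n. free_to_Q2 (A n)) \<longlonglongrightarrow> x \<longrightarrow> (\<lambda>n. ?E (A n)) \<longlonglongrightarrow> y" for x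
  proof -
    obtain A where A: "(\<lambda>n. free_to_Q2 (A n)) \<longlonglongrightarrow> x" by (rule free_to_Q2_seq)
    have "Cauchy (\<lambda>n. ?E (A n))"
      using LIMSEQ_imp_Cauchy[OF A] unfolding Cauchy_def dist_norm by (meson bound le_less_trans)
    then obtain y where y: "(\<lambda>n. ?E (A n)) \<longlonglongrightarrow> y"
      using Cauchy_convergent convergent_def by blast
    have "(\<lambda>n. ?E (B n)) \<longlonglongrightarrow> y" if B: "(\<lambda>n. free_to_Q2 (B n)) \<longlonglongrightarrow> x" for B
    proof -
      have "(\<lambda>n. norm (free_to_Q2 (B n) - free_to_Q2 (A n))) \<longlonglongrightarrow> 0"
        using tendsto_norm[OF tendsto_diff[OF B A]] by simp
      then have "(\<lambda>n. ?E (B n) - ?E (A n)) \<longlonglongrightarrow> 0"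
        by (rule Lim_null_comparison[rotated]) (simp add: bound)
      from tendsto_add[OF this y] show ?thesis by simp
    qed
    then show ?thesis by blast
  qed
  then obtain f where f: "\<And>x A. (\<lambda>n. free_to_Q2 (A n)) \<longlonglongrightarrow> x \<Longrightarrow> (\<lambda>n. ?E (A n)) \<longlonglongrightarrow> f x"
    by metis
  have fE: "f (free_to_Q2 a) = ?E a" for a
    using f[of "\<lambda>_. a" "free_to_Q2 a"] by (simp add: LIMSEQ_const_iff)
  have hom: "f (x + y) = f x + f y" "f (x * y) = f x * f y" "f (c *\<^sub>C x) = c *\<^sub>C f x"
    "f (x\<^sup>\<star>) = (f x)\<^sup>\<star>" "norm (f x - f y) \<le> norm (x - y)" for x y c
  proof -
    obtain A B where A: "(\<lambda>n. free_to_Q2 (A n)) \<longlonglongrightarrow> x" and B: "(\<lambda>n. free_to_Q2 (B n)) \<longlonglongrightarrow> y"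
      by (metis free_to_Q2_seq)
    note fA = f[OF A] and fB = f[OF B]
    show "f (x + y) = f x + f y"
      using f[of "\<lambda>n. A n + B n", unfolded free_to_Q2_add, OF tendsto_add[OF A B]]
        tendsto_add[OF fA fB] by (simp add: free_eval_add LIMSEQ_unique)
    show "f (x * y) = f x * f y"
      using f[of "\<lambda>n. A n * B n", unfolded free_to_Q2_mult, OF tendsto_mult[OF A B]]
        tendsto_mult[OF fA fB] by (simp add: free_eval_mult LIMSEQ_unique)
    show "f (c *\<^sub>C x) = c *\<^sub>C f x"
      using f[of "\<lambda>n. free_scale c (A n)", unfolded free_to_Q2_scale, OF tendsto_scaleC[OF A]]
        tendsto_scaleC[OF fA, of c] by (simp add: free_eval_scale LIMSEQ_unique)
    show "f (x\<^sup>\<star>) = (f x)\<^sup>\<star>"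
      using f[of "\<lambda>n. free_adj (A n)", unfolded free_to_Q2_adj, OF tendsto_adj[OF A]]
        tendsto_adj[OF fA] by (simp add: free_eval_adj LIMSEQ_unique)
    show "norm (f x - f y) \<le> norm (x - y)"
      by (rule LIMSEQ_le[OF tendsto_norm[OF tendsto_diff[OF fA fB]] tendsto_norm[OF tendsto_diff[OF A B]]])
        (simp add: bound)
  qed
  have "continuous_on UNIV f"
    unfolding continuous_on_iff dist_norm using hom(5) by (meson le_less_trans)
  moreover have "f Q2_U = u" "f Q2_S = s" by (simp_all add: Q2_U_def Q2_S_def fE)
  moreover have "f 1 = 1" using fE[of 1] by (simp add: free_to_Q2_1)
  ultimately show "\<exists>f. unital_star_hom f \<and> continuous_on UNIV f \<and> f Q2_U = u \<and> f Q2_S = s"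
    using hom(1-4) by (auto simp: unital_star_hom_def)
next
  fix f g :: "Q2 \<Rightarrow> 'a"
  assume f: "unital_star_hom f \<and> continuous_on UNIV f \<and> f Q2_U = u \<and> f Q2_S = s"
    and g: "unital_star_hom g \<and> continuous_on UNIV g \<and> g Q2_U = u \<and> g Q2_S = s"
  have eq: "f (free_to_Q2 a) = g (free_to_Q2 a)" for a
    using f g by (simp add: free_to_Q2_eval free_eval_hom)
  have "f x = g x" for x
  proof -
    obtain A where A: "(\<lambda>n. free_to_Q2 (A n)) \<longlonglongrightarrow> x" by (rule free_to_Q2_seq)
    have "(\<lambda>n. f (free_to_Q2 (A n))) \<longlonglongrightarrow> f x" "(\<lambda>n. g (free_to_Q2 (A n))) \<longlonglongrightarrow> g x"
      using f g A by (auto intro: continuous_on_tendsto_compose)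
    then show ?thesis by (simp add: eq LIMSEQ_unique)
  qed
  then show "f = g" by blast
qed


section \<open>The canonical endomorphism\<close>

definition canonical_endo :: "Q2 \<Rightarrow> Q2" where
  "canonical_endo x = Q2_U * Q2_S * x * Q2_S\<^sup>\<star> * Q2_U\<^sup>\<star> + Q2_S * x * Q2_S\<^sup>\<star>"

lemma unital_star_hom_canonical_endo: "unital_star_hom canonical_endo"
proof -
  define S T where "S = Q2_S" and "T = Q2_U * Q2_S"
  note rel = Q2_relations_generators[unfolded Q2_relations_def, folded S_def]
  have endo: "canonical_endo x = T * x * T\<^sup>\<star> + S * x * S\<^sup>\<star>" for x
    by (simp add: canonical_endo_def T_def S_def adj_mult mult.assoc)
  have SS: "S\<^sup>\<star> * S = 1" using rel by simp
  have UU: "Q2_U\<^sup>\<star> * (Q2_U * x) = x" for x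
    using rel by (metis mult.assoc mult_1_left)
  have TT: "T\<^sup>\<star> * T = 1"
    using SS by (simp add: T_def adj_mult mult.assoc UU flip: S_def)
  have sum: "T * T\<^sup>\<star> + S * S\<^sup>\<star> = 1"
    using rel by (simp add: T_def adj_mult mult.assoc add.commute flip: S_def)
  define k where "k = S\<^sup>\<star> * T"
  have "S\<^sup>\<star> * (T * T\<^sup>\<star> + S * S\<^sup>\<star>) * S = k * k\<^sup>\<star> + (S\<^sup>\<star> * S) * (S\<^sup>\<star> * S)"
    by (simp add: k_def adj_mult adj_adj algebra_simps)
  then have "k * k\<^sup>\<star> = 0" by (simp add: sum SS)
  then have "norm (k\<^sup>\<star>) = 0" using cstar_identity[of "k\<^sup>\<star>"] by (simp add: adj_adj)
  then have "k = 0" by (simp add: norm_adj)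
  then have ST: "S\<^sup>\<star> * T = 0" by (simp add: k_def)
  have TS: "T\<^sup>\<star> * S = 0"
    using arg_cong[OF ST, of adj] adj_diff[of "0::Q2" 0] by (simp add: adj_mult adj_adj)
  have ext: "S\<^sup>\<star> * (S * x) = x" "T\<^sup>\<star> * (T * x) = x" "S\<^sup>\<star> * (T * x) = 0" "T\<^sup>\<star> * (S * x) = 0" for x
    using SS TT ST TS by (simp_all flip: mult.assoc)
  show ?thesis
    unfolding unital_star_hom_def endo
    by (auto simp: algebra_simps ext sum[unfolded add.commute[of "T * _"]] adj_add adj_mult adj_adj scaleC_add_right
        mult_scaleC_left mult_scaleC_right)
qed

end

theory Submission
  imports Defs
begin

text \<open>
  The reason is that the endomorphism \<open>\<phi>\<close> has a contractive left inverse, the transfer operator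
  \<open>L y = (T\<^sup>\<star> y T + S\<^sup>\<star> y S) / 2\<close> with \<open>T = U S\<close>, which contracts the whole algebra to the
  scalars: \<open>L\<^sup>k a\<close> converges to a multiple of \<open>1\<close> for every \<open>*\<close>-polynomial \<open>a\<close> in \<open>U\<close> and \<open>S\<close>
  (lemma \<open>transfer_limit_free_eval\<close>).

  By linearity it is enough to see this for a monomial \<open>y\<close>. The relation \<open>S U = U\<^sup>2 S\<close> brings \<open>y\<close>,
  unless it vanishes, into the form \<open>U\<^sup>a S\<^sup>m (S\<^sup>\<star>)\<^sup>n U\<^sup>b\<close>. If \<open>m > 0\<close> or \<open>n > 0\<close>, one of the two
  monomials \<open>S\<^sup>\<star> y S\<close> and \<open>T\<^sup>\<star> y T\<close> is zero, because \<open>S\<^sup>\<star> U\<^sup>j S = 0\<close> for odd \<open>j\<close>; so \<open>L y\<close> is half a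
  monomial. If \<open>y = U\<^sup>a\<close>, then \<open>L y = S\<^sup>\<star> U\<^sup>a S\<close> is \<open>U\<^bsup>a/2\<^esup>\<close> or \<open>0\<close>, according to the parity of
  \<open>a\<close>, so the iterates reach \<open>0\<close> or \<open>1\<close> after finitely many steps. As monomials have norm at
  most \<open>1\<close>, an orbit that never meets the powers of \<open>U\<close> tends to zero.

  Now let \<open>x = \<phi>\<^sup>k x\<^sub>k\<close> for all \<open>k\<close>; then \<open>x\<^sub>k = L\<^sup>k x\<close>. Choose a \<open>*\<close>-polynomial \<open>a\<close> close to \<open>x\<close>
  and \<open>k\<close> with \<open>L\<^sup>k a\<close> close to \<open>c 1\<close>. Then \<open>x\<^sub>k\<close> is close to \<open>c 1\<close>, and applying the contraction
  \<open>\<phi>\<^sup>k\<close>, which fixes the scalars, so is \<open>x\<close>. The scalars form a closed set.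
\<close>

section \<open>Monomials in the generators\<close>

locale two_adic_pair =
  fixes u s :: "'a::unital_cstar_algebra"
  assumes rel: "Q2_relations u s"
begin

lemma uu: "u\<^sup>\<star> * u = 1" "u * u\<^sup>\<star> = 1" and ss: "s\<^sup>\<star> * s = 1"
  and su: "s * u = u * u * s" and range_sum: "s * s\<^sup>\<star> + u * s * s\<^sup>\<star> * u\<^sup>\<star> = 1"
  using rel by (auto simp: Q2_relations_def power2_eq_square)

lemma uu_left: "u\<^sup>\<star> * (u * x) = x" "u * (u\<^sup>\<star> * x) = x" and ss_left: "s\<^sup>\<star> * (s * x) = x"
  using uu ss by (simp_all flip: mult.assoc)

text \<open>
  The ranges of \<open>s\<close> and \<open>u s\<close> are orthogonal: compressing \<open>s s\<^sup>\<star> + u s s\<^sup>\<star> u\<^sup>\<star> = 1\<close> by \<open>s\<close> leaves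
  \<open>1 + k k\<^sup>\<star> = 1\<close> with \<open>k = s\<^sup>\<star> u s\<close>.
\<close>

lemma sus: "s\<^sup>\<star> * u * s = 0"
proof -
  define k where "k = s\<^sup>\<star> * u * s"
  have "s\<^sup>\<star> * (s * s\<^sup>\<star> + u * s * s\<^sup>\<star> * u\<^sup>\<star>) * s = 1 + k * k\<^sup>\<star>"
    by (simp add: k_def adj_mult adj_adj distrib_left distrib_right mult.assoc ss ss_left)
  then have "k * k\<^sup>\<star> = 0" by (simp add: range_sum ss)
  then have "norm (k\<^sup>\<star>) = 0" using cstar_identity[of "k\<^sup>\<star>"] by (simp add: adj_adj)
  then show ?thesis by (simp add: norm_adj k_def)
qed

text \<open>As \<open>u\<close> is unitary, these are its integer powers, with the adjoint as inverse.\<close>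

definition upow :: "int \<Rightarrow> 'a" where
  "upow a = (if a \<ge> 0 then u ^ nat a else (u\<^sup>\<star>) ^ nat (- a))"

lemma upow_0 [simp]: "upow 0 = 1"
  by (simp add: upow_def)

lemma upow_Suc: "upow (a + 1) = u * upow a"
proof (cases "a \<ge> 0")
  case True
  then have "nat (a + 1) = Suc (nat a)" by simp
  with True show ?thesis by (simp add: upow_def)
next
  case False
  then have "nat (- a) = Suc (nat (- a - 1))" by simp
  with False show ?thesis
    by (cases "a = -1") (simp_all add: upow_def uu uu_left)
qed

lemma upow_pred: "upow (a - 1) = u\<^sup>\<star> * upow a"
  using upow_Suc[of "a - 1"] by (simp add: uu_left)

lemma upow_1: "upow 1 = u" "upow (-1) = u\<^sup>\<star>"
  using upow_Suc[of 0] upow_pred[of 0] by simp_all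

lemma upow_add: "upow (a + b) = upow a * upow b"
proof (induction a rule: int_induct[where k = 0])
  case (step1 a)
  then show ?case using upow_Suc[of "a + b"] upow_Suc[of a] by (simp add: algebra_simps)
next
  case (step2 a)
  then show ?case using upow_pred[of "a + b"] upow_pred[of a] by (simp add: algebra_simps)
qed simp

lemma s_upow: "s * upow a = upow (2 * a) * s"
proof (induction a rule: int_induct[where k = 0])
  case (step1 a)
  have "s * upow (a + 1) = u * u * (s * upow a)"
    by (simp add: upow_Suc su flip: mult.assoc)
  also have "\<dots> = upow (2 * (a + 1)) * s"
    using upow_Suc[of "2 * a"] upow_Suc[of "2 * a + 1"] by (simp add: step1 mult.assoc algebra_simps)
  finally show ?case .
next
  case (step2 a)
  have "u * u * s * u\<^sup>\<star> = s"
    by (metis mult.assoc mult_1_right su uu(2))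
  then have "s * u\<^sup>\<star> = u\<^sup>\<star> * (u\<^sup>\<star> * s)"
    by (metis mult.assoc uu_left(1))
  then have "s * upow (a - 1) = u\<^sup>\<star> * (u\<^sup>\<star> * (s * upow a))"
    by (simp add: upow_pred flip: mult.assoc)
  also have "\<dots> = upow (2 * (a - 1)) * s"
    using upow_pred[of "2 * a"] upow_pred[of "2 * a - 1"] by (simp add: step2 mult.assoc)
  finally show ?case .
qed simp

lemma adj_upow: "(upow a)\<^sup>\<star> = upow (- a)"
proof -
  have "(u ^ n)\<^sup>\<star> = (u\<^sup>\<star>) ^ n" for n
    by (induction n) (simp_all add: adj_mult power_commutes)
  then show ?thesis by (auto simp: upow_def adj_adj) (metis adj_adj)
qed

lemma upow_sadj: "upow a * s\<^sup>\<star> = s\<^sup>\<star> * upow (2 * a)"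
  using arg_cong[OF s_upow[of "- a"], of adj] by (simp add: adj_mult adj_upow)

lemma upow_sadj_power: "upow a * (s\<^sup>\<star>) ^ n = (s\<^sup>\<star>) ^ n * upow (2 ^ n * a)"
proof (induction n arbitrary: a)
  case (Suc n)
  have "upow a * (s\<^sup>\<star>) ^ Suc n = s\<^sup>\<star> * (upow (2 * a) * (s\<^sup>\<star>) ^ n)"
    by (simp add: upow_sadj flip: mult.assoc)
  then show ?case by (simp add: Suc[of "2 * a"] mult.assoc) (simp add: mult.left_commute)
qed simp

lemma sadj_upow_s_even: "s\<^sup>\<star> * upow (2 * a) * s = upow a"
  by (simp add: mult.assoc ss_left flip: s_upow)

lemma sadj_upow_s_odd: "odd a \<Longrightarrow> s\<^sup>\<star> * upow a * s = 0"
proof (elim oddE)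
  fix b assume "a = 2 * b + 1"
  then have "s\<^sup>\<star> * upow a * s = s\<^sup>\<star> * u * s * upow b"
    by (simp add: upow_Suc mult.assoc s_upow)
  then show "s\<^sup>\<star> * upow a * s = 0" by (simp add: sus)
qed

definition monomial :: "int \<Rightarrow> nat \<Rightarrow> nat \<Rightarrow> int \<Rightarrow> 'a" where
  "monomial a m n b = upow a * s ^ m * (s\<^sup>\<star>) ^ n * upow b"

text \<open>
  The normal form survives multiplication by a letter from the left. The one letter that needs an
  argument is \<open>s\<^sup>\<star>\<close>: it cancels a factor \<open>s\<close> across \<open>u\<^sup>a\<close> or annihilates it, and when no factor
  \<open>s\<close> is present, \<open>u\<^sup>a\<close> moves to the right through the powers of \<open>s\<^sup>\<star>\<close>.
\<close>

lemma monomial_letter: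
  "eval_letter u s l * monomial a m n b = 0 \<or>
    (\<exists>a' m' n' b'. eval_letter u s l * monomial a m n b = monomial a' m' n' b')"
proof -
  have U: "u * monomial a m n b = monomial (a + 1) m n b"
       "u\<^sup>\<star> * monomial a m n b = monomial (a - 1) m n b"
    by (simp_all add: monomial_def upow_Suc upow_pred mult.assoc)
  have S: "s * monomial a m n b = monomial (2 * a) (Suc m) n b"
    by (simp add: monomial_def s_upow flip: mult.assoc)
  have A: "s\<^sup>\<star> * monomial a m n b = 0 \<or>
    (\<exists>a' m' n' b'. s\<^sup>\<star> * monomial a m n b = monomial a' m' n' b')"
  proof (cases m)
    case 0
    have "s\<^sup>\<star> * monomial a m n b = s\<^sup>\<star> * (upow a * (s\<^sup>\<star>) ^ n) * upow b"
      by (simp add: monomial_def 0 mult.assoc)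
    also have "\<dots> = monomial 0 0 (Suc n) (2 ^ n * a + b)"
      by (simp add: upow_sadj_power monomial_def upow_add mult.assoc)
    finally show ?thesis by blast
  next
    case (Suc k)
    have eq: "s\<^sup>\<star> * monomial a m n b = s\<^sup>\<star> * upow a * s * (s ^ k * (s\<^sup>\<star>) ^ n * upow b)"
      by (simp add: monomial_def Suc mult.assoc)
    show ?thesis
    proof (cases "even a")
      case True
      then obtain c where "a = 2 * c" by blast
      then have "s\<^sup>\<star> * monomial a m n b = monomial c k n b"
        unfolding eq by (simp only: sadj_upow_s_even monomial_def flip: mult.assoc)
      then show ?thesis by blast
    qed (simp add: eq sadj_upow_s_odd)
  qed
  obtain g d where l: "l = (g, d)" by force
  show ?thesis
    using U S A unfolding l by (cases g; cases d) auto
qed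

lemma eval_word_normal_form:
  "eval_word u s w = 0 \<or> (\<exists>a m n b. eval_word u s w = monomial a m n b)"
proof -
  have "prod_list (map (eval_letter u s) l) = 0 \<or>
        (\<exists>a m n b. prod_list (map (eval_letter u s) l) = monomial a m n b)" for l
  proof (induction l)
    case Nil
    have "1 = monomial 0 0 0 0" by (simp add: monomial_def)
    then show ?case by auto
  next
    case (Cons x l)
    then show ?case 
      using monomial_letter[of x] by (metis list.simps(9) mult_zero_right prod_list.Cons)
  qed
  then show ?thesis by (simp add: eval_word_def)
qed

lemma norm_eval_word: "norm (eval_word u s w) \<le> 1"
proof -
  have "norm (eval_word u s w) \<le> univ_norm (Poly_Mapping.single w 1)"
    using free_eval_bound[OF rel, of "Poly_Mapping.single w 1"] by (simp add: free_eval_single)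
  also have "\<dots> \<le> 1"
    using admissible_word[OF univ_norm_admissible, of "letters w"] by simp
  finally show ?thesis .
qed

section \<open>The transfer operator\<close>

definition transfer_op :: "'a \<Rightarrow> 'a" where
  "transfer_op y = (1 / 2) *\<^sub>C (s\<^sup>\<star> * y * s + s\<^sup>\<star> * u\<^sup>\<star> * y * u * s)"

lemma transfer_op_add: "transfer_op (x + y) = transfer_op x + transfer_op y"
  by (simp add: transfer_op_def algebra_simps scaleC_add_right)

lemma transfer_op_scale: "transfer_op (c *\<^sub>C x) = c *\<^sub>C transfer_op x"
  by (simp add: transfer_op_def mult_scaleC_left mult_scaleC_right scaleC_scaleC mult.commute
      flip: scaleC_add_right)

lemma transfer_op_0: "transfer_op 0 = 0"
  using transfer_op_add[of 0 0] by simp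

lemma transfer_pow_add: "(transfer_op ^^ k) (x + y) = (transfer_op ^^ k) x + (transfer_op ^^ k) y"
  by (induction k) (simp_all add: transfer_op_add)

lemma transfer_pow_diff: "(transfer_op ^^ k) (x - y) = (transfer_op ^^ k) x - (transfer_op ^^ k) y"
  using transfer_pow_add[of k "x - y" y] by simp

lemma transfer_pow_scale: "(transfer_op ^^ k) (c *\<^sub>C x) = c *\<^sub>C (transfer_op ^^ k) x"
  by (induction k) (simp_all add: transfer_op_scale)

lemma transfer_op_norm: "norm (transfer_op x) \<le> norm x"
proof -
  have compress: "norm (t\<^sup>\<star> * x * t) \<le> norm x" if "norm t \<le> 1" for t
  proof -
    have "norm (t\<^sup>\<star> * x * t) \<le> norm (t\<^sup>\<star> * x) * norm t" by (rule norm_mult_ineq)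
    also have "\<dots> \<le> norm (t\<^sup>\<star>) * norm x * norm t"
      by (intro mult_right_mono norm_mult_ineq) simp
    also have "\<dots> \<le> 1 * norm x * 1"
      using that by (intro mult_mono) (simp_all add: norm_adj)
    finally show ?thesis by simp
  qed
  have "norm s \<le> 1" "norm (u * s) \<le> 1"
    using norm_eval_word[of "Word [(GS, False)]"] norm_eval_word[of "Word [(GU, False), (GS, False)]"]
    by (simp_all add: eval_word_def)
  from this[THEN compress] show ?thesis
    using norm_triangle_ineq[of "s\<^sup>\<star> * x * s" "s\<^sup>\<star> * u\<^sup>\<star> * x * u * s"]
    by (simp add: transfer_op_def norm_scaleC adj_mult mult.assoc)
qed

lemma transfer_pow_norm: "norm ((transfer_op ^^ k) x) \<le> norm x"
  by (induction k) (auto intro: order_trans[OF transfer_op_norm])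

text \<open>
  The two summands of the transfer operator are again monomials. One vanishes on
  \<open>u\<^sup>a s\<^sup>m (s\<^sup>\<star>)\<^sup>n u\<^sup>b\<close> with \<open>m > 0\<close> because \<open>a\<close> or \<open>a - 1\<close> is odd, and with \<open>n > 0\<close> because \<open>b\<close> or
  \<open>b + 1\<close> is odd.
\<close>

lemma transfer_op_word:
  "(\<exists>a. eval_word u s w = upow a) \<or> (\<exists>v. transfer_op (eval_word u s w) = (1 / 2) *\<^sub>C eval_word u s v)
    \<or> transfer_op (eval_word u s w) = 0"
proof -
  let ?y = "eval_word u s w"
  have v1: "s\<^sup>\<star> * ?y * s = eval_word u s (Word [(GS, True)] + w + Word [(GS, False)])"
    by (simp add: eval_word_add) (simp add: eval_word_def)
  have v2: "s\<^sup>\<star> * u\<^sup>\<star> * ?y * u * s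
      = eval_word u s (Word [(GS, True), (GU, True)] + w + Word [(GU, False), (GS, False)])"
    by (simp add: eval_word_add) (simp add: eval_word_def mult.assoc)
  have half: ?thesis if "s\<^sup>\<star> * ?y * s = 0 \<or> s\<^sup>\<star> * u\<^sup>\<star> * ?y * u * s = 0"
    using that
  proof
    assume "s\<^sup>\<star> * ?y * s = 0"
    then have "transfer_op ?y = (1 / 2) *\<^sub>C (s\<^sup>\<star> * u\<^sup>\<star> * ?y * u * s)" by (simp add: transfer_op_def)
    then show ?thesis unfolding v2 by blast
  next
    assume "s\<^sup>\<star> * u\<^sup>\<star> * ?y * u * s = 0"
    then have "transfer_op ?y = (1 / 2) *\<^sub>C (s\<^sup>\<star> * ?y * s)" by (simp add: transfer_op_def)
    then show ?thesis unfolding v1 by blast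
  qed
  consider "?y = 0" | a m n b where "?y = monomial a m n b"
    using eval_word_normal_form by blast
  then show ?thesis
  proof cases
    case 1
    then show ?thesis by (simp add: transfer_op_0)
  next
    case (2 a m n b)
    consider "m = 0 \<and> n = 0" | k where "m = Suc k" | k where "n = Suc k"
      by (metis not0_implies_Suc)
    then show ?thesis
    proof cases
      case 1
      then show ?thesis using 2 by (auto simp: monomial_def simp flip: upow_add)
    next
      case (2 k)
      let ?z = "s ^ k * (s\<^sup>\<star>) ^ n * upow b"
      have "s\<^sup>\<star> * ?y * s = s\<^sup>\<star> * upow a * s * (?z * s)"
        "s\<^sup>\<star> * u\<^sup>\<star> * ?y * u * s = s\<^sup>\<star> * upow (a - 1) * s * (?z * (u * s))"
        using \<open>?y = monomial a m n b\<close> 2 by (simp_all add: monomial_def upow_pred mult.assoc)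
      then show ?thesis
        by (cases "even a") (auto intro!: half simp: sadj_upow_s_odd)
    next
      case (3 k)
      let ?z = "upow a * s ^ m * (s\<^sup>\<star>) ^ k"
      have n: "(s\<^sup>\<star>) ^ n = (s\<^sup>\<star>) ^ k * s\<^sup>\<star>" by (simp add: 3 power_commutes)
      have "upow (b + 1) = upow b * u" by (simp add: upow_add upow_1)
      then have "s\<^sup>\<star> * ?y * s = s\<^sup>\<star> * ?z * (s\<^sup>\<star> * upow b * s)"
        "s\<^sup>\<star> * u\<^sup>\<star> * ?y * u * s = s\<^sup>\<star> * u\<^sup>\<star> * ?z * (s\<^sup>\<star> * upow (b + 1) * s)"
        using \<open>?y = monomial a m n b\<close> by (simp_all add: monomial_def n mult.assoc)
      then show ?thesis
        by (cases "even b") (auto intro!: half simp: sadj_upow_s_odd)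
    qed
  qed
qed

section \<open>Convergence of the transfer operator to the scalars\<close>

text \<open>
  Monomials suffice to establish this property for all \<open>*\<close>-polynomials, because it passes to linear
  combinations; and it may be checked on any iterate, because it depends only on the tail of the orbit.
\<close>

definition transfer_limit :: "'a \<Rightarrow> bool" where
  "transfer_limit y \<longleftrightarrow> (\<exists>c. (\<lambda>k. (transfer_op ^^ k) y) \<longlonglongrightarrow> c *\<^sub>C 1)"

lemma transfer_limit_add:
  assumes "transfer_limit x" "transfer_limit y"
  shows "transfer_limit (x + y)"
proof -
  obtain c d where "(\<lambda>k. (transfer_op ^^ k) x) \<longlonglongrightarrow> c *\<^sub>C 1" "(\<lambda>k. (transfer_op ^^ k) y) \<longlonglongrightarrow> d *\<^sub>C 1"
    using assms unfolding transfer_limit_def by blast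
  from tendsto_add[OF this] show ?thesis
    unfolding transfer_limit_def transfer_pow_add by (simp only: flip: scaleC_add_left) (rule exI)
qed

lemma transfer_limit_scale:
  assumes "transfer_limit x"
  shows "transfer_limit (c *\<^sub>C x)"
proof -
  obtain d where "(\<lambda>k. (transfer_op ^^ k) x) \<longlonglongrightarrow> d *\<^sub>C 1"
    using assms unfolding transfer_limit_def by blast
  from tendsto_scaleC[OF this, of c] show ?thesis
    unfolding transfer_limit_def transfer_pow_scale scaleC_scaleC by (rule exI)
qed

lemma transfer_limit_shift: "transfer_limit ((transfer_op ^^ j) x) \<longleftrightarrow> transfer_limit x"
proof -
  have "(transfer_op ^^ k) ((transfer_op ^^ j) x) = (transfer_op ^^ (k + j)) x" for k
    by (simp add: funpow_add)
  then show ?thesis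
    unfolding transfer_limit_def
    by (simp, intro ex_cong1 iffI) (erule LIMSEQ_offset, erule LIMSEQ_ignore_initial_segment)
qed

lemma transfer_limit_0: "transfer_limit 0"
proof -
  have "(transfer_op ^^ k) 0 = 0" for k by (induction k) (simp_all add: transfer_op_0)
  then show ?thesis unfolding transfer_limit_def by (auto intro!: exI[of _ 0])
qed

lemma transfer_op_upow: "transfer_op (upow a) = s\<^sup>\<star> * upow a * s"
proof -
  have "upow a = u\<^sup>\<star> * (upow a * u)"
    using upow_add[of "-1" "a + 1"] by (simp add: upow_1 upow_add)
  then have "transfer_op (upow a) = (1 / 2) *\<^sub>C (s\<^sup>\<star> * upow a * s + s\<^sup>\<star> * upow a * s)"
    unfolding transfer_op_def by (metis mult.assoc)
  also have "\<dots> = s\<^sup>\<star> * upow a * s"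
    by (simp add: scaleC_add_right flip: scaleC_add_left)
  finally show ?thesis .
qed

text \<open>Each step halves an even exponent, and an odd exponent is sent to \<open>0\<close>.\<close>

lemma transfer_limit_upow: "transfer_limit (upow a)"
proof (induction "nat \<bar>a\<bar>" arbitrary: a rule: less_induct)
  case less
  have step: "transfer_limit (upow a)" if "transfer_limit (transfer_op (upow a))"
    using transfer_limit_shift[of 1 "upow a"] that by simp
  consider "a = 0" | "odd a" | c where "a = 2 * c" "c \<noteq> 0"
    by (metis evenE mult_zero_right)
  then show ?case
  proof cases
    case 1
    have "(transfer_op ^^ k) 1 = 1" for k
      using transfer_op_upow[of 0] by (induction k) (simp_all add: ss)
    then show ?thesis
      using 1 unfolding transfer_limit_def by (auto intro!: exI[of _ 1])
  next
    case 2
    then show ?thesis by (intro step) (simp add: transfer_op_upow sadj_upow_s_odd transfer_limit_0)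
  next
    case (3 c)
    then show ?thesis
      using less[of c] by (intro step) (simp add: transfer_op_upow sadj_upow_s_even)
  qed
qed

lemma transfer_limit_word: "transfer_limit (eval_word u s w)"
proof (rule ccontr)
  assume non: "\<not> transfer_limit (eval_word u s w)"
  \<comment> \<open>Were the orbit to reach \<open>0\<close> or a power of \<open>u\<close>, it would converge; so it is halved at every step.\<close>
  have orbit: "\<exists>v. (transfer_op ^^ k) (eval_word u s w) = (1 / 2) ^ k *\<^sub>C eval_word u s v" for k
  proof (induction k)
    case 0
    show ?case by (auto intro!: exI[of _ w])
  next
    case (Suc k)
    then obtain v where v: "(transfer_op ^^ k) (eval_word u s w) = (1 / 2) ^ k *\<^sub>C eval_word u s v"
      by blast
    have nonv: "\<not> transfer_limit (eval_word u s v)"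
      using non transfer_limit_shift[of k "eval_word u s w"] transfer_limit_scale by (metis v)
    then have "transfer_op (eval_word u s v) \<noteq> 0"
      using transfer_limit_shift[of 1 "eval_word u s v"] transfer_limit_0 by auto
    moreover have "eval_word u s v \<noteq> upow a" for a
      using nonv transfer_limit_upow by metis
    ultimately obtain v' where "transfer_op (eval_word u s v) = (1 / 2) *\<^sub>C eval_word u s v'"
      using transfer_op_word[of v] by blast
    then have "(transfer_op ^^ Suc k) (eval_word u s w) = (1 / 2) ^ Suc k *\<^sub>C eval_word u s v'"
      by (simp add: v transfer_op_scale scaleC_scaleC mult.commute)
    then show ?case by blast
  qed
  have bound: "norm ((transfer_op ^^ k) (eval_word u s w)) \<le> (1 / 2) ^ k" for k
  proof -
    obtain v where "(transfer_op ^^ k) (eval_word u s w) = (1 / 2) ^ k *\<^sub>C eval_word u s v"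
      using orbit by blast
    then have "norm ((transfer_op ^^ k) (eval_word u s w)) = (1 / 2) ^ k * norm (eval_word u s v)"
      by (simp add: norm_scaleC norm_power norm_divide)
    also have "\<dots> \<le> (1 / 2) ^ k * 1"
      by (intro mult_left_mono norm_eval_word) simp
    finally show ?thesis by simp
  qed
  have lim: "(\<lambda>k. (1 / 2) ^ k :: real) \<longlonglongrightarrow> 0" by (intro LIMSEQ_power_zero) simp
  have "(\<lambda>k. (transfer_op ^^ k) (eval_word u s w)) \<longlonglongrightarrow> 0"
    by (rule Lim_null_comparison[OF always_eventually[OF allI[OF bound]] lim])
  then have "transfer_limit (eval_word u s w)"
    unfolding transfer_limit_def by (intro exI[of _ 0]) simp
  with non show False by simp
qed

lemma transfer_limit_free_eval: "transfer_limit (free_eval u s a)"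
proof (induction a rule: free_induct)
  case (single w c)
  show ?case
    unfolding free_eval_single by (intro transfer_limit_scale transfer_limit_word)
next
  case (add x y)
  then show ?case
    unfolding free_eval_add by (rule transfer_limit_add)
qed

end

section \<open>The canonical endomorphism\<close>

interpretation Q2: two_adic_pair Q2_U Q2_S
  by standard (rule Q2_relations_generators)

text \<open>
  With \<open>T = U S\<close>, compressing \<open>T x T\<^sup>\<star> + S x S\<^sup>\<star>\<close> by either isometry returns \<open>x\<close>, because \<open>S\<close> and \<open>T\<close>
  have orthogonal ranges.
\<close>

lemma transfer_canonical_endo: "Q2.transfer_op (canonical_endo x) = x"
proof -
  have zero: "Q2_S\<^sup>\<star> * (Q2_U * (Q2_S * y)) = 0" "Q2_S\<^sup>\<star> * (Q2_U\<^sup>\<star> * (Q2_S * y)) = 0" for y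
    using Q2.sus Q2.sadj_upow_s_odd[of "-1"] by (simp_all add: Q2.upow_1 flip: mult.assoc)
  have zero': "Q2_S\<^sup>\<star> * (Q2_U * Q2_S) = 0" "Q2_S\<^sup>\<star> * (Q2_U\<^sup>\<star> * Q2_S) = 0"
    using zero[of 1] by simp_all
  note simps = distrib_left distrib_right mult.assoc Q2.uu Q2.uu_left Q2.ss Q2.ss_left zero zero'
  have "Q2_S\<^sup>\<star> * canonical_endo x * Q2_S = x"
    unfolding canonical_endo_def by (simp add: simps)
  moreover have "Q2_S\<^sup>\<star> * Q2_U\<^sup>\<star> * canonical_endo x * Q2_U * Q2_S = x"
    unfolding canonical_endo_def by (simp add: simps)
  ultimately have "Q2.transfer_op (canonical_endo x) = (1 / 2) *\<^sub>C (x + x)"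
    unfolding Q2.transfer_op_def by simp
  also have "\<dots> = (1 / 2 + 1 / 2) *\<^sub>C x"
    by (simp only: scaleC_add_right scaleC_add_left)
  finally show ?thesis by simp
qed

lemma transfer_pow_canonical_endo: "(Q2.transfer_op ^^ k) ((canonical_endo ^^ k) x) = x"
proof (induction k)
  case (Suc k)
  have "(Q2.transfer_op ^^ Suc k) ((canonical_endo ^^ Suc k) x)
      = (Q2.transfer_op ^^ k) (Q2.transfer_op (canonical_endo ((canonical_endo ^^ k) x)))"
    by (metis funpow_swap1 funpow_simps_right(2) comp_apply)
  also have "\<dots> = x"
    by (simp only: transfer_canonical_endo Suc)
  finally show ?case .
qed simp

text \<open>
  The universal norm dominates every representation of the relations, in particular the one
  obtained by applying the endomorphism to the generators.
\<close>

lemma canonical_endo_norm: "norm (canonical_endo x) \<le> norm x"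
proof -
  note hom = unital_star_hom_canonical_endo
  have "Q2_relations (canonical_endo Q2_U) (canonical_endo Q2_S)"
    using Q2_relations_generators hom unfolding Q2_relations_def unital_star_hom_def power2_eq_square
    by metis
  then have bound: "norm (canonical_endo (free_to_Q2 a)) \<le> norm (free_to_Q2 a)" for a
    unfolding norm_free_to_Q2 unfolding free_to_Q2_eval free_eval_hom[OF hom]
    by (rule free_eval_bound)
  obtain A where A: "(\<lambda>n. free_to_Q2 (A n)) \<longlonglongrightarrow> x" by (rule free_to_Q2_seq)
  have "(\<lambda>n. canonical_endo (free_to_Q2 (A n))) \<longlonglongrightarrow> canonical_endo x"
    unfolding canonical_endo_def by (intro tendsto_intros A)
  from LIMSEQ_le[OF tendsto_norm[OF this] tendsto_norm[OF A]] show ?thesis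
    using bound by blast
qed

lemma canonical_endo_scalar: "canonical_endo (c *\<^sub>C 1) = c *\<^sub>C 1"
  using unital_star_hom_canonical_endo by (simp add: unital_star_hom_def)

lemma canonical_endo_pow_scalar: "(canonical_endo ^^ k) (c *\<^sub>C 1) = c *\<^sub>C 1"
  by (induction k) (simp_all add: canonical_endo_scalar)

lemma canonical_endo_pow_dist_scalar:
  "norm ((canonical_endo ^^ k) x - c *\<^sub>C 1) \<le> norm (x - c *\<^sub>C 1)"
proof (induction k)
  case (Suc k)
  have "canonical_endo (y - z) = canonical_endo y - canonical_endo z" for y z
    using unital_star_hom_canonical_endo unfolding unital_star_hom_def
    by (metis add_diff_cancel diff_add_cancel)
  then have "norm ((canonical_endo ^^ Suc k) x - c *\<^sub>C 1)
      = norm (canonical_endo ((canonical_endo ^^ k) x - c *\<^sub>C 1))"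
    by (simp add: canonical_endo_scalar)
  also have "\<dots> \<le> norm (x - c *\<^sub>C 1)"
    using canonical_endo_norm Suc by (rule order_trans)
  finally show ?case .
qed simp

text \<open>
  In a nonzero algebra the scalars are, up to the factor \<open>norm 1\<close>, an isometric copy of the
  complex numbers, hence complete.
\<close>

lemma closed_scalars: "closed (range (\<lambda>c. c *\<^sub>C (1::'a::unital_cstar_algebra)))"
proof (cases "(1::'a) = 0")
  case True
  then have "c *\<^sub>C (1::'a) = 0" for c using norm_scaleC[of c "1::'a"] by simp
  then show ?thesis by simp
next
  case False
  have "bounded_linear (\<lambda>c. c *\<^sub>C (1::'a))"
    by (rule bounded_linear_intro[where K = "norm (1::'a)"])
      (simp_all add: scaleC_add_left norm_scaleC scaleR_scaleC scaleC_scaleC scaleR_conv_of_real)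
  then have "complete ((\<lambda>c. c *\<^sub>C (1::'a)) ` UNIV)"
    using False
    by (intro complete_isometric_image[where e = "norm (1::'a)"])
      (simp_all add: norm_scaleC complete_UNIV)
  then show ?thesis by (rule complete_imp_closed)
qed

theorem theorem3p14:
  shows "(\<Inter>k\<in>{k::nat. k > 0}. range (canonical_endo ^^ k)) = range (\<lambda>c. c *\<^sub>C (1::Q2))"
proof (intro equalityI subsetI)
  fix x assume "x \<in> range (\<lambda>c. c *\<^sub>C (1::Q2))"
  then have "x = (canonical_endo ^^ k) x" for k
    by (auto simp: canonical_endo_pow_scalar)
  then show "x \<in> (\<Inter>k\<in>{k::nat. k > 0}. range (canonical_endo ^^ k))"
    by blast
next
  fix x assume x: "x \<in> (\<Inter>k\<in>{k::nat. k > 0}. range (canonical_endo ^^ k))"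
  have "\<exists>y\<in>range (\<lambda>c. c *\<^sub>C (1::Q2)). dist y x < e" if e: "e > 0" for e
  proof -
    obtain a where a: "norm (x - free_to_Q2 a) < e / 2" 
      using Q2_approx[of "e / 2" x] e by auto
    obtain c where "(\<lambda>k. (Q2.transfer_op ^^ k) (free_to_Q2 a)) \<longlonglongrightarrow> c *\<^sub>C 1"
      using Q2.transfer_limit_free_eval unfolding Q2.transfer_limit_def free_to_Q2_eval by blast
    then obtain N where N: "\<And>k. k \<ge> N \<Longrightarrow> norm ((Q2.transfer_op ^^ k) (free_to_Q2 a) - c *\<^sub>C 1) < e / 2"
      using e by (meson LIMSEQ_D half_gt_zero)
    define k where "k = Suc N"
    have "k > 0" by (simp add: k_def)
    \<comment> \<open>The preimage \<open>y\<close> is \<open>L\<^sup>k x\<close>, hence close to \<open>L\<^sup>k a\<close>.\<close>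
    with x obtain y where y: "x = (canonical_endo ^^ k) y" by blast
    have "norm (y - (Q2.transfer_op ^^ k) (free_to_Q2 a)) \<le> norm (x - free_to_Q2 a)"
      using Q2.transfer_pow_norm[of k "x - free_to_Q2 a"]
      by (simp add: Q2.transfer_pow_diff y transfer_pow_canonical_endo)
    moreover have "norm ((Q2.transfer_op ^^ k) (free_to_Q2 a) - c *\<^sub>C 1) < e / 2"
      by (rule N) (simp add: k_def)
    ultimately have "norm (y - c *\<^sub>C 1) < e"
      using a norm_triangle_ineq[of "y - (Q2.transfer_op ^^ k) (free_to_Q2 a)"
          "(Q2.transfer_op ^^ k) (free_to_Q2 a) - c *\<^sub>C 1"] by simp
    then have "norm (x - c *\<^sub>C 1) < e"
      using canonical_endo_pow_dist_scalar[of k y c] by (simp add: y)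
    then show ?thesis by (auto simp: dist_norm norm_minus_commute)
  qed
  then have "x \<in> closure (range (\<lambda>c. c *\<^sub>C (1::Q2)))" by (auto simp: closure_approachable)
  then show "x \<in> range (\<lambda>c. c *\<^sub>C (1::Q2))" by (simp only: closure_closed[OF closed_scalars])
qed

end
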